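(* Assume $\ell_1=\ell_2=\pi$. Then the semigroup $(S_2(t))_{t\ge0}$ generated by $\mathcal{A}_2$ is not exponentially stable on $\mathcal{H}_2$. Moreover, for every $\alpha<1$, $\limsup_{\lambda\in\mathbb{R},|\lambda|\to\infty}|\lambda|^{-\alpha}\|(i\lambda I-\mathcal{A}_2)^{-1}\|_{\mathcal{L}(\mathcal{H}_2)}=\infty.$
   Context: Let $\ell_1=\ell_2=\pi$ and positive constants $\alpha_1,\alpha_2,\beta_2,\gamma_2,\delta_2,\tau_2,\kappa_2$. $\|\cdot\|$ denotes the $L^2$ norm on the relevant interval; primes denote $x$-derivatives. Let $V=\{(f_1,f_2)\in H^1(0,\ell_1)\times H^2(0,\ell_2): f_1(\ell_1)=0,\ f_2(\ell_2)=0,\ f_1(0)=f_2(0),\ f_2'(0)=0\}$. Let $\mathcal{H}_2=V\times L^2(0,\ell_1)\times L^2(0,\ell_2)\times L^2(0,\ell_2)\times L^2(0,\ell_2)$ with elements $(f_1,f_2,g_1,g_2,h_2,d_2)$ and norm $\|\cdot\|_{\mathcal{H}_2}^2=\alpha_1\|f_1'\|^2+\|g_1\|^2+\frac{\delta_2}{\beta_2}\big(\alpha_2\|f_2''\|^2+\|g_2\|^2\big)+\|h_2\|^2+\frac{\gamma_2\tau_2}{\kappa_2}\|d_2\|^2$. Define $\mathcal{D}(\mathcal{A}_2)$ as the set of $(u_1,u_2,v_1,v_2,\theta_2,q_2)\in\mathcal{H}_2$ with $u_1\in H^2(0,\ell_1)$, $(v_1,v_2)\in V$, $\theta_2\in H^1_0(0,\ell_2)$,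 $q_2\in H^1(0,\ell_2)$, $\alpha_2u_2''-\beta_2\theta_2\in H^2(0,\ell_2)$, $u_2''(\ell_2)=0$ and $\frac{\delta_2}{\beta_2}(\alpha_2u_2''-\beta_2\theta_2)'(0)=\alpha_1u_1'(0)$, and $\mathcal{A}_2(u_1,u_2,v_1,v_2,\theta_2,q_2)=\big(v_1,\ v_2,\ \alpha_1u_1'',\ (-\alpha_2u_2''+\beta_2\theta_2)'',\ -\delta_2v_2''-\gamma_2q_2',\ -\tfrac1{\tau_2}q_2-\tfrac{\kappa_2}{\tau_2}\theta_2'\big)$. $\mathcal{A}_2$ generates a $C_0$-semigroup of contractions $(S_2(t))_{t\ge0}$ on $\mathcal{H}_2$ and $i\mathbb{R}\subset\rho(\mathcal{A}_2)$. *)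

theory Defs
  imports "HOL-Analysis.Analysis"
begin

(* Both intervals are (0,pi).  Functions are complex valued (the resolvent is
   evaluated at i*lambda).  Lebesgue measure (complete) is used throughout. *)

type_synonym fn = "real \<Rightarrow> complex"
type_synonym st = "fn \<times> fn \<times> fn \<times> fn \<times> fn \<times> fn"

abbreviation I0 :: "real set" where "I0 \<equiv> {0..pi}"

definition l2 :: "fn \<Rightarrow> bool" where
  "l2 f \<longleftrightarrow> set_borel_measurable lebesgue I0 f \<and>
              set_integrable lebesgue I0 (\<lambda>x. (norm (f x))\<^sup>2)"

definition nrm2 :: "fn \<Rightarrow> real" where
  "nrm2 f = set_lebesgue_integral lebesgue I0 (\<lambda>x. (norm (f x))\<^sup>2)"

(* pointwise derivative (one-sided at the end points); for Sobolev functions it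
   agrees a.e. with the weak derivative *)
definition dv :: "fn \<Rightarrow> fn" where
  "dv f x = vector_derivative f (at x within I0)"

(* f is the (absolutely) continuous representative: f(x) = f(0) + int_0^x g *)
definition wderiv :: "fn \<Rightarrow> fn \<Rightarrow> bool" where
  "wderiv f g \<longleftrightarrow> set_integrable lebesgue I0 g \<and>
     (\<forall>x\<in>I0. f x = f 0 + set_lebesgue_integral lebesgue {0..x} g)"

definition H1 :: "fn \<Rightarrow> bool" where
  "H1 f \<longleftrightarrow> l2 f \<and> l2 (dv f) \<and> wderiv f (dv f)"

definition H2 :: "fn \<Rightarrow> bool" where
  "H2 f \<longleftrightarrow> H1 f \<and> H1 (dv f)"

definition inV :: "fn \<Rightarrow> fn \<Rightarrow> bool" where
  "inV f1 f2 \<longleftrightarrow> H1 f1 \<and> H2 f2 \<and> f1 pi = 0 \<and> f2 pi = 0 \<and> f1 0 = f2 0 \<and> dv f2 0 = 0"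

definition inH :: "st \<Rightarrow> bool" where
  "inH U = (case U of (f1, f2, g1, g2, h2, d2) \<Rightarrow>
      inV f1 f2 \<and> l2 g1 \<and> l2 g2 \<and> l2 h2 \<and> l2 d2)"

definition normH :: "real \<Rightarrow> real \<Rightarrow> real \<Rightarrow> real \<Rightarrow> real \<Rightarrow> real \<Rightarrow> real \<Rightarrow> st \<Rightarrow> real" where
  "normH a1 a2 b2 g2 d2 t2 k2 U = (case U of (f1, f2, g1, g2', h2, e2) \<Rightarrow>
      sqrt (a1 * nrm2 (dv f1) + nrm2 g1 + d2 / b2 * (a2 * nrm2 (dv (dv f2)) + nrm2 g2')
            + nrm2 h2 + g2 * t2 / k2 * nrm2 e2))"

definition wfun :: "real \<Rightarrow> real \<Rightarrow> fn \<Rightarrow> fn \<Rightarrow> fn" where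
  "wfun a2 b2 u2 th = (\<lambda>x. of_real a2 * dv (dv u2) x - of_real b2 * th x)"

(* the domain D(A_2).  Requiring H1 (dv (dv u2)) only fixes the continuous
   representative of u2'' (it is implied by the other conditions), so that the
   trace u2''(pi) is a point value. *)
definition inD :: "real \<Rightarrow> real \<Rightarrow> real \<Rightarrow> real \<Rightarrow> real \<Rightarrow> real \<Rightarrow> real \<Rightarrow> st \<Rightarrow> bool" where
  "inD a1 a2 b2 g2 d2 t2 k2 U = (case U of (u1, u2, v1, v2, th, q) \<Rightarrow>
      inH U \<and> H2 u1 \<and> inV v1 v2 \<and> H1 th \<and> th 0 = 0 \<and> th pi = 0 \<and> H1 q \<and>
      H1 (dv (dv u2)) \<and> H2 (wfun a2 b2 u2 th) \<and> dv (dv u2) pi = 0 \<and>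
      of_real (d2 / b2) * dv (wfun a2 b2 u2 th) 0 = of_real a1 * dv u1 0)"

definition opA :: "real \<Rightarrow> real \<Rightarrow> real \<Rightarrow> real \<Rightarrow> real \<Rightarrow> real \<Rightarrow> real \<Rightarrow> st \<Rightarrow> st" where
  "opA a1 a2 b2 g2 d2 t2 k2 U = (case U of (u1, u2, v1, v2, th, q) \<Rightarrow>
      (v1, v2, (\<lambda>x. of_real a1 * dv (dv u1) x),
       (\<lambda>x. - dv (dv (wfun a2 b2 u2 th)) x),
       (\<lambda>x. - of_real d2 * dv (dv v2) x - of_real g2 * dv q x),
       (\<lambda>x. - of_real (1 / t2) * q x - of_real (k2 / t2) * dv th x)))"

definition st_lin :: "complex \<Rightarrow> st \<Rightarrow> complex \<Rightarrow> st \<Rightarrow> st" where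
  "st_lin a U b W = (case U of (u1, u2, u3, u4, u5, u6) \<Rightarrow> case W of (w1, w2, w3, w4, w5, w6) \<Rightarrow>
      ((\<lambda>x. a * u1 x + b * w1 x), (\<lambda>x. a * u2 x + b * w2 x), (\<lambda>x. a * u3 x + b * w3 x),
       (\<lambda>x. a * u4 x + b * w4 x), (\<lambda>x. a * u5 x + b * w5 x), (\<lambda>x. a * u6 x + b * w6 x)))"

definition classical_sol :: "real \<Rightarrow> real \<Rightarrow> real \<Rightarrow> real \<Rightarrow> real \<Rightarrow> real \<Rightarrow> real \<Rightarrow> (real \<Rightarrow> st) \<Rightarrow> bool" where
  "classical_sol a1 a2 b2 g2 d2 t2 k2 U \<longleftrightarrow>
     (\<forall>t\<ge>0. inD a1 a2 b2 g2 d2 t2 k2 (U t) \<and>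
        ((\<lambda>s. normH a1 a2 b2 g2 d2 t2 k2
                 (st_lin (of_real (1 / (s - t))) (st_lin 1 (U s) (-1) (U t))
                         (-1) (opA a1 a2 b2 g2 d2 t2 k2 (U t))))
          \<longlongrightarrow> 0) (at t within {0..}))"

(* exponential stability of S_2(t): ||S_2(t) U0|| <= M e^(-omega t) ||U0||.
   Since S_2(t) U0 is the classical solution for U0 in D(A_2), D(A_2) is dense and
   S_2(t) is bounded, this is equivalent to the estimate on classical solutions. *)
definition exp_stable :: "real \<Rightarrow> real \<Rightarrow> real \<Rightarrow> real \<Rightarrow> real \<Rightarrow> real \<Rightarrow> real \<Rightarrow> bool" where
  "exp_stable a1 a2 b2 g2 d2 t2 k2 \<longleftrightarrow>
     (\<exists>M \<omega>. \<omega> > 0 \<and> (\<forall>U. classical_sol a1 a2 b2 g2 d2 t2 k2 U \<longrightarrow>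
        (\<forall>t\<ge>0. normH a1 a2 b2 g2 d2 t2 k2 (U t) \<le> M * exp (- \<omega> * t) * normH a1 a2 b2 g2 d2 t2 k2 (U 0))))"

definition res_norm :: "real \<Rightarrow> real \<Rightarrow> real \<Rightarrow> real \<Rightarrow> real \<Rightarrow> real \<Rightarrow> real \<Rightarrow> real \<Rightarrow> ereal" where
  "res_norm a1 a2 b2 g2 d2 t2 k2 l =
     (SUP U \<in> {U. inD a1 a2 b2 g2 d2 t2 k2 U \<and>
        normH a1 a2 b2 g2 d2 t2 k2 (st_lin (\<i> * of_real l) U (-1) (opA a1 a2 b2 g2 d2 t2 k2 U)) \<le> 1}.
        ereal (normH a1 a2 b2 g2 d2 t2 k2 U))"

end

theory Submission
  imports Defs "HOL-Library.Landau_Symbols"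
begin

text \<open>It suffices to exhibit eigenvalues \<open>l\<close> of the operator with \<open>Im l \<rightarrow> \<infinity>\<close> and
  \<open>\<bar>Re l\<bar> = O(1 / Im l)\<close>: the solution \<open>exp (l t) U\<close> started at an eigenvector decays no faster than
  \<open>exp (Re l t)\<close>, and the resolvent at \<open>\<i> Im l\<close> has norm at least \<open>1 / \<bar>Re l\<bar>\<close>.

  Because all conditions at \<open>pi\<close> are of Dirichlet type, an eigenvector is a combination of functions
  \<open>sinh (k (pi - x))\<close>: one wave number \<open>l / sqrt a1\<close> for the wave, and three for the plate, the squares of
  which are \<open>l\<close> times the roots of a cubic whose coefficients depend on \<open>l\<close> only through a parameter
  \<open>sigma = O(1 / l)\<close>. The conditions at the junction reduce to \<open>tanh (l pi / sqrt a1) = G\<close>. Among the wave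
  frequencies \<open>n sqrt a1\<close> we select those near \<open>sqrt beta M\<^sup>2\<close> with \<open>M = m + 3/4\<close>. They stay away from the
  resonances of the plate, the three plate wave numbers are close to \<open>\<i> M\<close>, to \<open>M\<close> and to a multiple of
  \<open>l\<close>, and \<open>G = \<i> C / M + O(1 / M\<^sup>2)\<close> with \<open>C\<close> real. Solving the equation near \<open>\<i> n sqrt a1\<close> by Brouwer's theorem
  gives \<open>Re l = O(1 / M\<^sup>2)\<close>.\<close>

section \<open>Continuously differentiable functions\<close>

text \<open>At frequency M^2 the wave sees the plate only through the ratio \<open>G\<close> of
  displacement to flux. Its leading term is imaginary: such a load shifts the frequency but takes no
  energy, so any damping sits in the remainder of order 1/M^2, that is 1/|\<lambda>|. Hence the
  resolvent grows at least like |\<lambda>| along the chosen frequencies, which is where the bound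
  \<alpha> < 1 comes from. The obstacle is that the eigenvalue, the roots of the cubic and the wave
  numbers are tied together implicitly. The roots are not expanded as functions of l; l and the
  three roots together are the unknown of one fixed-point problem. Brouwer's theorem then asks only
  for continuity and limits, not for derivatives or contraction constants. The limits are proved for
  arbitrary sequences taken from the search regions and made uniform by selecting a worst point in
  each. The fixed points form such a sequence themselves, so the same expansions yield the real
  part. The third, thermal wave number is the delicate one: it has size M^2 but bounded real part,
  so its hyperbolic cotangent is only known to stay bounded.\<close>

definition cderiv :: "fn \<Rightarrow> fn \<Rightarrow> bool" where
  "cderiv f f' \<longleftrightarrow> (\<forall>x\<in>I0. (f has_vector_derivative f' x) (at x within I0)) \<and> continuous_on I0 f'"

lemma cderiv_cong:
  assumes "\<And>x. x \<in> I0 \<Longrightarrow> f x = g x" "\<And>x. x \<in> I0 \<Longrightarrow> f' x = g' x" "cderiv f f'"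
  shows "cderiv g g'"
proof -
  have "(g has_vector_derivative g' x) (at x within I0)" if "x \<in> I0" for x
    using assms that unfolding cderiv_def
    by (metis has_vector_derivative_transform)
  moreover have "continuous_on I0 g'"
    using assms unfolding cderiv_def by (metis continuous_on_cong)
  ultimately show ?thesis by (auto simp: cderiv_def)
qed

lemma cderiv_imp_continuous: "cderiv f f' \<Longrightarrow> continuous_on I0 f"
  unfolding cderiv_def continuous_on_eq_continuous_within
  by (blast intro: has_vector_derivative_continuous)

lemma dv_eq:
  assumes "cderiv f f'" "x \<in> I0"
  shows "dv f x = f' x"
  unfolding dv_def
  by (rule vector_derivative_within_closed_interval) (use assms in \<open>auto simp: cderiv_def\<close>)

lemma cderiv_dv: "cderiv f f' \<Longrightarrow> cderiv f' f'' \<Longrightarrow> cderiv (dv f) f''"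
  by (rule cderiv_cong[of f' _ f'']) (auto simp: dv_eq)

lemma l2_cong: "(\<And>x. x \<in> I0 \<Longrightarrow> f x = g x) \<Longrightarrow> l2 f \<longleftrightarrow> l2 g"
  unfolding l2_def set_borel_measurable_def set_integrable_def
  by (intro arg_cong2[where f="(\<and>)"] arg_cong2[where f=measurable] arg_cong2[where f="\<lambda>x y. x \<in> y"]
        arg_cong2[where f=integrable]) (auto simp: indicator_def fun_eq_iff)

lemma nrm2_cong: "(\<And>x. x \<in> I0 \<Longrightarrow> f x = g x) \<Longrightarrow> nrm2 f = nrm2 g"
  unfolding nrm2_def by (rule set_lebesgue_integral_cong) auto

lemma continuous_imp_l2:
  assumes "continuous_on I0 f"
  shows "l2 f"
proof -
  have "set_borel_measurable lebesgue I0 f"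
    using borel_measurable_continuous_on_indicator[OF _ assms]
    by (simp add: set_borel_measurable_def measurable_completion)
  moreover have "set_integrable lborel I0 (\<lambda>x. (norm (f x))\<^sup>2)"
    by (intro borel_integrable_atLeastAtMost' continuous_intros assms)
  ultimately show ?thesis
    by (auto simp: l2_def set_integrable_def integrable_completion)
qed

text \<open>The fundamental theorem of calculus gives the Henstock-Kurzweil integral of the
  classical derivative, which is then identified with the Lebesgue integral that
  \<open>wderiv\<close> asks for.\<close>

lemma cderiv_imp_H1:
  assumes "cderiv f f'"
  shows "H1 f"
proof -
  have c: "continuous_on I0 f'" using assms by (simp add: cderiv_def)
  have "l2 (dv f)" using continuous_imp_l2[OF c] dv_eq[OF assms] l2_cong by metis
  moreover have "l2 f" by (intro continuous_imp_l2 cderiv_imp_continuous[OF assms])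
  moreover have "wderiv f (dv f)"
    unfolding wderiv_def
  proof (intro conjI ballI)
    have "set_integrable lebesgue I0 f'"
      using borel_integrable_atLeastAtMost'[OF c]
      by (auto simp: set_integrable_def integrable_completion)
    then show int: "set_integrable lebesgue I0 (dv f)"
      by (subst set_integrable_cong[OF refl refl]) (auto simp: dv_eq[OF assms])
    fix x assume x: "x \<in> I0"
    have "(f has_vector_derivative f' y) (at y within {0..x})" if "y \<in> {0..x}" for y
      by (rule has_vector_derivative_within_subset[of f _ _ I0])
        (use x that assms in \<open>auto simp: cderiv_def\<close>)
    then have "(f' has_integral f x - f 0) {0..x}"
      by (intro fundamental_theorem_of_calculus) (use x in auto)
    then have "(dv f has_integral f x - f 0) {0..x}"
      by (rule has_integral_eq[rotated]) (use x dv_eq[OF assms] in auto)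
    moreover have "set_integrable lebesgue {0..x} (dv f)"
      using set_integrable_subset[OF int] x by auto
    ultimately show "f x = f 0 + set_lebesgue_integral lebesgue {0..x} (dv f)"
      by (metis has_integral_set_lebesgue has_integral_unique add.commute diff_add_cancel)
  qed
  ultimately show ?thesis by (simp add: H1_def)
qed

lemma cderiv_imp_H2: "cderiv f f' \<Longrightarrow> cderiv f' f'' \<Longrightarrow> H2 f"
  unfolding H2_def using cderiv_imp_H1 cderiv_dv by blast

lemma nrm2_nonneg: "nrm2 f \<ge> 0"
  unfolding nrm2_def set_lebesgue_integral_def
  by (rule Bochner_Integration.integral_nonneg) (auto simp: indicator_def)

lemma nrm2_mult: "nrm2 (\<lambda>x. c * f x) = (norm c)\<^sup>2 * nrm2 f"
  unfolding nrm2_def by (simp add: norm_mult power_mult_distrib)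

text \<open>A continuous nonnegative integrand with zero integral over an interval with interior
  vanishes everywhere, so a single point with \<open>f x \<noteq> 0\<close> suffices.\<close>

lemma nrm2_pos:
  assumes "continuous_on I0 f" "x \<in> I0" "f x \<noteq> 0"
  shows "nrm2 f > 0"
proof (rule ccontr)
  assume "\<not> nrm2 f > 0"
  then have 0: "nrm2 f = 0" using nrm2_nonneg[of f] by linarith
  have c: "continuous_on I0 (\<lambda>x. (norm (f x))\<^sup>2)"
    by (intro continuous_intros assms)
  have "set_integrable lebesgue I0 (\<lambda>x. (norm (f x))\<^sup>2)"
    using continuous_imp_l2[OF assms(1)] by (simp add: l2_def)
  then have "((\<lambda>x. (norm (f x))\<^sup>2) has_integral 0) I0"
    using has_integral_set_lebesgue 0 unfolding nrm2_def by metis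
  moreover have "box 0 pi \<noteq> {}" by (simp add: not_le)
  ultimately have "(norm (f x))\<^sup>2 = 0"
    using has_integral_0_cbox_imp_0[of 0 pi "\<lambda>x. (norm (f x))\<^sup>2" x] c assms(2)
    unfolding box_real by simp
  then show False using assms(3) by simp
qed

section \<open>Sums of hyperbolic functions and their derivatives\<close>

definition sinh_sum :: "'j set \<Rightarrow> ('j \<Rightarrow> complex) \<Rightarrow> ('j \<Rightarrow> complex) \<Rightarrow> fn" where
  "sinh_sum J k A x = (\<Sum>j\<in>J. A j * sinh (k j * of_real (pi - x)))"

definition cosh_sum :: "'j set \<Rightarrow> ('j \<Rightarrow> complex) \<Rightarrow> ('j \<Rightarrow> complex) \<Rightarrow> fn" where
  "cosh_sum J k A x = (\<Sum>j\<in>J. A j * cosh (k j * of_real (pi - x)))"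

lemma continuous_sinh_sum [continuous_intros]: "continuous_on S (sinh_sum J k A)"
  unfolding sinh_sum_def by (intro continuous_intros)

lemma continuous_cosh_sum [continuous_intros]: "continuous_on S (cosh_sum J k A)"
  unfolding cosh_sum_def by (intro continuous_intros)

lemma cderiv_sinh_sum: "cderiv (sinh_sum J k A) (cosh_sum J k (\<lambda>j. - k j * A j))"
proof -
  have "(sinh_sum J k A has_vector_derivative cosh_sum J k (\<lambda>j. - k j * A j) x) (at x within I0)" for x
    unfolding sinh_sum_def cosh_sum_def
    by (rule has_vector_derivative_sum)
      (auto intro!: derivative_eq_intros has_vector_derivative_real_field simp: algebra_simps)
  then show ?thesis by (auto simp: cderiv_def intro: continuous_intros)
qed

lemma cderiv_cosh_sum: "cderiv (cosh_sum J k A) (sinh_sum J k (\<lambda>j. - k j * A j))"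
proof -
  have "(cosh_sum J k A has_vector_derivative sinh_sum J k (\<lambda>j. - k j * A j) x) (at x within I0)" for x
    unfolding sinh_sum_def cosh_sum_def
    by (rule has_vector_derivative_sum)
      (auto intro!: derivative_eq_intros has_vector_derivative_real_field simp: algebra_simps)
  then show ?thesis by (auto simp: cderiv_def intro: continuous_intros)
qed

section \<open>Eigenvectors\<close>

definition state_eq :: "st \<Rightarrow> st \<Rightarrow> bool" where
  "state_eq U W = (case U of (u1, u2, u3, u4, u5, u6) \<Rightarrow> case W of (w1, w2, w3, w4, w5, w6) \<Rightarrow>
     (\<forall>x\<in>I0. u1 x = w1 x \<and> u2 x = w2 x \<and> u3 x = w3 x \<and> u4 x = w4 x \<and> u5 x = w5 x \<and> u6 x = w6 x))"

lemma dv_cong: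
  assumes "\<And>y. y \<in> I0 \<Longrightarrow> f y = g y" "x \<in> I0"
  shows "dv f x = dv g x"
proof -
  have "(f has_vector_derivative d) (at x within I0) \<longleftrightarrow> (g has_vector_derivative d) (at x within
      I0)" for d
    using assms by (metis has_vector_derivative_transform)
  then show ?thesis by (simp add: dv_def vector_derivative_def)
qed

lemma normH_cong:
  assumes "state_eq U W"
  shows "normH a1 a2 b2 g2 d2 t2 k2 U = normH a1 a2 b2 g2 d2 t2 k2 W"
proof -
  obtain u1 u2 u3 u4 u5 u6 w1 w2 w3 w4 w5 w6
    where U: "U = (u1, u2, u3, u4, u5, u6)" and W: "W = (w1, w2, w3, w4, w5, w6)"
    by (metis prod_cases6)
  have eq: "u1 x = w1 x \<and> u2 x = w2 x \<and> u3 x = w3 x \<and> u4 x = w4 x \<and> u5 x = w5 x \<and> u6 x = w6 x"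
    if "x \<in> I0" for x
    using assms that by (auto simp: state_eq_def U W)
  have "dv u1 x = dv w1 x" if "x \<in> I0" for x by (rule dv_cong) (use eq that in auto)
  moreover have "dv (dv u2) x = dv (dv w2) x" if "x \<in> I0" for x
    by (rule dv_cong[OF dv_cong]) (use eq that in auto)
  ultimately have "nrm2 (dv u1) = nrm2 (dv w1)" "nrm2 (dv (dv u2)) = nrm2 (dv (dv w2))"
      "nrm2 u3 = nrm2 w3" "nrm2 u4 = nrm2 w4" "nrm2 u5 = nrm2 w5" "nrm2 u6 = nrm2 w6"
    using eq by (auto intro!: nrm2_cong)
  then show ?thesis by (simp add: normH_def U W)
qed

lemma state_eq_trans: "state_eq U V \<Longrightarrow> state_eq V W \<Longrightarrow> state_eq U W"
  by (cases U rule: prod_cases6; cases V rule: prod_cases6; cases W rule: prod_cases6)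
    (simp add: state_eq_def)

lemma state_eq_refl: "state_eq U U"
  by (cases U rule: prod_cases6) (simp add: state_eq_def)

lemma state_eq_st_lin:
  "state_eq U V \<Longrightarrow> state_eq U' V' \<Longrightarrow> state_eq (st_lin a U b U') (st_lin a V b V')"
  by (cases U rule: prod_cases6; cases V rule: prod_cases6; cases U' rule: prod_cases6;
      cases V' rule: prod_cases6) (simp add: state_eq_def st_lin_def)

lemma sinh_sum_pi [simp]: "sinh_sum J k A pi = 0"
  by (simp add: sinh_sum_def)

lemma sinh_sum_mult: "c * sinh_sum J k A x = sinh_sum J k (\<lambda>j. c * A j) x"
  by (simp add: sinh_sum_def sum_distrib_left mult.assoc)

lemma cosh_sum_mult: "c * cosh_sum J k A x = cosh_sum J k (\<lambda>j. c * A j) x"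
  by (simp add: cosh_sum_def sum_distrib_left mult.assoc)

lemma sinh_sum_lincomb:
  "a * sinh_sum J k (\<lambda>j. c * A j) x + b * sinh_sum J k (\<lambda>j. d * A j) x =
    sinh_sum J k (\<lambda>j. (a * c + b * d) * A j) x"
  by (simp add: sinh_sum_def sum_distrib_left distrib_right sum.distrib mult.assoc)

lemma cosh_sum_lincomb:
  "a * cosh_sum J k (\<lambda>j. c * A j) x + b * cosh_sum J k (\<lambda>j. d * A j) x =
    cosh_sum J k (\<lambda>j. (a * c + b * d) * A j) x"
  by (simp add: cosh_sum_def sum_distrib_left distrib_right sum.distrib mult.assoc)

lemma dv_sinh_sum: "x \<in> I0 \<Longrightarrow> dv (sinh_sum J k A) x = cosh_sum J k (\<lambda>j. - k j * A j) x"
  by (rule dv_eq[OF cderiv_sinh_sum])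

lemma dv_cosh_sum: "x \<in> I0 \<Longrightarrow> dv (cosh_sum J k A) x = sinh_sum J k (\<lambda>j. - k j * A j) x"
  by (rule dv_eq[OF cderiv_cosh_sum])

lemma dv_dv_sinh_sum: "x \<in> I0 \<Longrightarrow> dv (dv (sinh_sum J k A)) x = sinh_sum J k (\<lambda>j. (k j)\<^sup>2 * A j) x"
  by (subst dv_eq[OF cderiv_dv[OF cderiv_sinh_sum cderiv_cosh_sum]])
    (auto simp: power2_eq_square mult.assoc)

locale plate_wave =
  fixes a1 a2 b2 g2 d2 t2 k2 :: real
  assumes pos: "a1 > 0" "a2 > 0" "b2 > 0" "g2 > 0" "d2 > 0" "t2 > 0" "k2 > 0"
begin

abbreviation "nH \<equiv> normH a1 a2 b2 g2 d2 t2 k2"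
abbreviation "Dom \<equiv> inD a1 a2 b2 g2 d2 t2 k2"
abbreviation "Op \<equiv> opA a1 a2 b2 g2 d2 t2 k2"

text \<open>\<open>U c\<close> is \<open>c\<close> times a fixed eigenvector; states are compared on the interval only, since \<open>dv\<close> is
  unspecified outside of it.\<close>

definition eigen_family :: "complex \<Rightarrow> (complex \<Rightarrow> st) \<Rightarrow> real \<Rightarrow> bool" where
  "eigen_family l U \<nu> \<longleftrightarrow> \<nu> > 0 \<and>
     (\<forall>c. Dom (U c) \<and> nH (U c) = norm c * \<nu> \<and> state_eq (Op (U c)) (U (l * c))) \<and>
     (\<forall>a b c d. state_eq (st_lin a (U c) b (U d)) (U (a * c + b * d)))"

lemma eigen_family_resolvent:
  assumes "eigen_family l U \<nu>"
  shows "nH (st_lin a (U c) b (Op (U c))) = norm (a * c + b * (l * c)) * \<nu>"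
proof -
  have "state_eq (st_lin a (U c) b (Op (U c))) (U (a * c + b * (l * c)))"
    using assms state_eq_trans[OF state_eq_st_lin[OF state_eq_refl]] unfolding eigen_family_def by metis
  then show ?thesis
    using assms normH_cong unfolding eigen_family_def by metis
qed

text \<open>Each mode has to solve the plate and the heat equation separately. The four boundary
  hypotheses are, in this order, continuity at the junction, u2'(0) = 0, \<theta>(0) = 0 and the
  flux balance. A wave component that does not vanish at the junction makes the eigenvector
  nonzero.\<close>

lemma eigen_family_exists:
  fixes k A B :: "'j \<Rightarrow> complex" and l \<kappa> Y :: complex
  assumes l: "l \<noteq> 0" "1 + t2 * l \<noteq> 0"
    and wave: "a1 * \<kappa>\<^sup>2 = l\<^sup>2" "Y * sinh (\<kappa> * pi) \<noteq> 0"
    and plate: "\<And>j. j \<in> J \<Longrightarrow> - (k j)\<^sup>2 * (a2 * (k j)\<^sup>2 * A j - b2 * B j) = l\<^sup>2 * A j"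
    and heat: "\<And>j. j \<in> J \<Longrightarrow> - d2 * l * (k j)\<^sup>2 * A j + g2 * k2 / (1 + t2 * l) * (k j)\<^sup>2 * B j = l * B j"
    and bc: "Y * sinh (\<kappa> * pi) = (\<Sum>j\<in>J. A j * sinh (k j * pi))"
      "(\<Sum>j\<in>J. k j * A j * cosh (k j * pi)) = 0" "(\<Sum>j\<in>J. B j * sinh (k j * pi)) = 0"
      "d2 / b2 * (\<Sum>j\<in>J. k j * (a2 * (k j)\<^sup>2 * A j - b2 * B j) * cosh (k j * pi))
        = a1 * \<kappa> * Y * cosh (\<kappa> * pi)"
  shows "\<exists>U \<nu>. eigen_family l U \<nu>"
proof -
  \<comment> \<open>The last component of the eigenvalue equation gives q = - k2 \<theta>' / (1 + t2
    l); the sign cancels because differentiating sinh (k (pi - x)) brings out -k.\<close>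
  define Q where "Q j = k2 * k j * B j / (1 + t2 * l)" for j
  define W where "W j = a2 * (k j)\<^sup>2 * A j - b2 * B j" for j
  define u1 where "u1 c = sinh_sum {0::nat} (\<lambda>_. \<kappa>) (\<lambda>_. c * Y)" for c
  define u2 where "u2 c = sinh_sum J k (\<lambda>j. c * A j)" for c
  define th where "th c = sinh_sum J k (\<lambda>j. c * B j)" for c
  define q where "q c = cosh_sum J k (\<lambda>j. c * Q j)" for c
  define U where "U c = (u1 c, u2 c, u1 (l * c), u2 (l * c), th c, q c)" for c
  note defs = u1_def u2_def th_def q_def
  have u1: "cderiv (u1 c) (cosh_sum {0::nat} (\<lambda>_. \<kappa>) (\<lambda>_. - \<kappa> * (c * Y)))" for c
    unfolding defs by (rule cderiv_sinh_sum)
  have u1': "dv (u1 c) x = - \<kappa> * c * Y * cosh (\<kappa> * (pi - x))" if "x \<in> I0" for c x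
    unfolding defs using that by (simp add: dv_sinh_sum cosh_sum_def)
  have u1'': "dv (dv (u1 c)) x = \<kappa>\<^sup>2 * u1 c x" if "x \<in> I0" for c x
    unfolding defs using that by (simp add: dv_dv_sinh_sum sinh_sum_def)
  have u2'': "dv (dv (u2 c)) x = sinh_sum J k (\<lambda>j. (k j)\<^sup>2 * (c * A j)) x" if "x \<in> I0" for c x
    unfolding defs by (rule dv_dv_sinh_sum[OF that])
  have w: "wfun a2 b2 (u2 c) (th c) x = sinh_sum J k (\<lambda>j. c * W j) x" if "x \<in> I0" for c x
    unfolding wfun_def u2''[OF that] th_def W_def
    by (simp add: sinh_sum_def sum_distrib_left sum_subtractf algebra_simps)
  have cw: "cderiv (wfun a2 b2 (u2 c) (th c)) (cosh_sum J k (\<lambda>j. - k j * (c * W j)))" for c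
    by (rule cderiv_cong[OF _ _ cderiv_sinh_sum]) (simp_all add: w)
  have inV: "inV (u1 c) (u2 c)" for c
    unfolding inV_def
  proof (intro conjI)
    show "H1 (u1 c)" by (rule cderiv_imp_H1[OF u1])
    show "H2 (u2 c)" unfolding defs by (rule cderiv_imp_H2[OF cderiv_sinh_sum cderiv_cosh_sum])
    show "u1 c 0 = u2 c 0" unfolding defs sinh_sum_mult[symmetric] using bc(1)
      by (simp add: sinh_sum_def)
    have "dv (u2 c) 0 = - c * (\<Sum>j\<in>J. k j * A j * cosh (k j * pi))" unfolding defs
      by (simp add: dv_sinh_sum cosh_sum_def sum_distrib_left sum_negf ac_simps)
    then show "dv (u2 c) 0 = 0" by (simp add: bc(2))
  qed (simp_all add: defs)
  have dom: "Dom (U c)" for c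
    unfolding inD_def inH_def U_def prod.case
  proof (intro conjI)
    show "inV (u1 c) (u2 c)" "inV (u1 (l * c)) (u2 (l * c))" by (rule inV)+
    show "l2 (u1 (l * c))" "l2 (u2 (l * c))" "l2 (th c)" "l2 (q c)"
      unfolding defs by (intro continuous_imp_l2 continuous_intros)+
    show "H2 (u1 c)" unfolding defs by (rule cderiv_imp_H2[OF cderiv_sinh_sum cderiv_cosh_sum])
    show "H1 (th c)" unfolding defs by (rule cderiv_imp_H1[OF cderiv_sinh_sum])
    show "H1 (q c)" unfolding defs by (rule cderiv_imp_H1[OF cderiv_cosh_sum])
    show "th c pi = 0" by (simp add: defs)
    show "th c 0 = 0" unfolding defs sinh_sum_mult[symmetric] using bc(3)
      by (simp add: sinh_sum_def)
    show "H1 (dv (dv (u2 c)))"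
      by (rule cderiv_imp_H1, rule cderiv_cong[OF _ _ cderiv_sinh_sum]) (simp_all add: u2'')
    show "dv (dv (u2 c)) pi = 0" by (simp add: u2'')
    show "H2 (wfun a2 b2 (u2 c) (th c))" by (rule cderiv_imp_H2[OF cw cderiv_cosh_sum])
    have "dv (wfun a2 b2 (u2 c) (th c)) 0 = - c * (\<Sum>j\<in>J. k j * W j * cosh (k j * pi))"
      by (subst dv_eq[OF cw]) (simp_all add: cosh_sum_def sum_distrib_left sum_negf mult_ac)
    then have "of_real (d2 / b2) * dv (wfun a2 b2 (u2 c) (th c)) 0 =
        - c * (d2 / b2 * (\<Sum>j\<in>J. k j * W j * cosh (k j * pi)))" by simp
    also have "\<dots> = - c * (a1 * \<kappa> * Y * cosh (\<kappa> * pi))"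
      using bc(4) unfolding W_def by simp
    also have "\<dots> = a1 * dv (u1 c) 0" by (simp add: u1')
    finally show "of_real (d2 / b2) * dv (wfun a2 b2 (u2 c) (th c)) 0 = a1 * dv (u1 c) 0" .
  qed
  have op: "state_eq (Op (U c)) (U (l * c))" for c
    unfolding state_eq_def U_def opA_def prod.case
  proof (intro ballI conjI)
    fix x assume x: "x \<in> I0"
    show "a1 * dv (dv (u1 c)) x = u1 (l * (l * c)) x"
    proof -
      have "a1 * dv (dv (u1 c)) x = (a1 * \<kappa>\<^sup>2) * u1 c x" using x by (simp add: u1'')
      also have "\<dots> = l\<^sup>2 * u1 c x" using wave(1) by simp
      also have "\<dots> = u1 (l * (l * c)) x" by (simp add: u1_def sinh_sum_def power2_eq_square)
      finally show ?thesis .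
    qed
    have "- dv (dv (wfun a2 b2 (u2 c) (th c))) x = - sinh_sum J k (\<lambda>j. (k j)\<^sup>2 * (c * W j)) x"
      using dv_eq[OF cderiv_dv[OF cw cderiv_cosh_sum] x]
      by (simp add: power2_eq_square mult.assoc)
    also have "\<dots> = u2 (l * (l * c)) x"
      unfolding defs sinh_sum_def sum_negf[symmetric]
    proof (rule sum.cong)
      fix j assume j: "j \<in> J"
      have "- ((k j)\<^sup>2 * (c * W j)) = c * (- (k j)\<^sup>2 * W j)" by simp
      also have "\<dots> = c * (l\<^sup>2 * A j)" using plate[OF j] by (simp add: W_def)
      also have "\<dots> = l * (l * c) * A j" by (simp add: power2_eq_square)
      finally show "- ((k j)\<^sup>2 * (c * W j) * sinh (k j * complex_of_real (pi - x))) =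
         l * (l * c) * A j * sinh (k j * complex_of_real (pi - x))"
        by (metis mult_minus_left)
    qed simp
    finally show "- dv (dv (wfun a2 b2 (u2 c) (th c))) x = u2 (l * (l * c)) x" .
    have "- of_real d2 * dv (dv (u2 (l * c))) x - g2 * dv (q c) x =
       sinh_sum J k (\<lambda>j. - d2 * ((k j)\<^sup>2 * (l * c * A j)) + g2 * (k j * (c * Q j))) x"
      using x by (simp add: u2'' q_def dv_cosh_sum sinh_sum_def sum_distrib_left sum_subtractf
          sum.distrib
          sum_negf algebra_simps)
    also have "\<dots> = th (l * c) x"
      unfolding defs sinh_sum_def
    proof (rule sum.cong)
      fix j assume j: "j \<in> J"
      have "- d2 * ((k j)\<^sup>2 * (l * c * A j)) + g2 * (k j * (c * Q j)) =
         c * (- d2 * l * (k j)\<^sup>2 * A j + g2 * k2 / (1 + t2 * l) * (k j)\<^sup>2 * B j)"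
        by (simp add: Q_def power2_eq_square algebra_simps)
      also have "\<dots> = l * c * B j" using heat[OF j] by simp
      finally show "(- d2 * ((k j)\<^sup>2 * (l * c * A j)) + g2 * (k j * (c * Q j))) *
         sinh (k j * complex_of_real (pi - x)) = l * c * B j * sinh (k j * complex_of_real (pi - x))"
        by simp
    qed simp
    finally show "- of_real d2 * dv (dv (u2 (l * c))) x - g2 * dv (q c) x = th (l * c) x" .
    have "- of_real (1 / t2) * q c x - of_real (k2 / t2) * dv (th c) x =
       cosh_sum J k (\<lambda>j. - of_real (1 / t2) * (c * Q j) + of_real (k2 / t2) * (k j * (c * B j))) x"
      using x by (simp add: th_def q_def dv_sinh_sum cosh_sum_def sum_distrib_left sum_subtractf
          sum.distrib
          sum_negf algebra_simps)
    also have "\<dots> = q (l * c) x"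
      unfolding defs cosh_sum_def
    proof (rule sum.cong)
      fix j assume j: "j \<in> J"
      have e: "(1 + t2 * l) * Q j = k2 * (k j * B j)"
        using l(2) by (simp add: Q_def)
      have "c * (k2 * (k j * B j)) - c * Q j = t2 * (l * c * Q j)"
        unfolding e[symmetric] by (simp add: algebra_simps)
      then have "- of_real (1 / t2) * (c * Q j) + of_real (k2 / t2) * (k j * (c * B j)) = l * c * Q j"
        using pos by (simp add: field_simps)
      then show "(- of_real (1 / t2) * (c * Q j) + of_real (k2 / t2) * (k j * (c * B j))) *
         cosh (k j * complex_of_real (pi - x)) = l * c * Q j * cosh (k j * complex_of_real (pi - x))"
        by simp
    qed simp
    finally show "- of_real (1 / t2) * q c x - of_real (k2 / t2) * dv (th c) x = q (l * c) x" .
  qed simp_all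
  have l_dist: "l * (a * c + b * d) = a * (l * c) + b * (l * d)" for a b c d
    by (simp add: algebra_simps)
  have lin: "state_eq (st_lin a (U c) b (U d)) (U (a * c + b * d))" for a b c d
    unfolding state_eq_def U_def st_lin_def prod.case defs l_dist
    by (simp only: sinh_sum_lincomb cosh_sum_lincomb) simp
  have scale1: "u1 (l * c) = (\<lambda>x. c * u1 l x)" for c
    by (rule ext) (simp add: u1_def sinh_sum_def)
  have scale2: "u2 (l * c) = (\<lambda>x. c * u2 l x)" for c
    unfolding u2_def sinh_sum_mult by (rule ext) (simp only: mult_ac)
  have scale3: "th c = (\<lambda>x. c * th 1 x)" for c
    unfolding th_def sinh_sum_mult mult_1_left ..
  have scale4: "q c = (\<lambda>x. c * q 1 x)" for c
    unfolding q_def cosh_sum_mult mult_1_left ..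
  have s1: "nrm2 (dv (u1 c)) = (norm c)\<^sup>2 * nrm2 (dv (u1 1))" for c
    unfolding nrm2_mult[symmetric] by (rule nrm2_cong) (simp add: u1')
  have s2: "nrm2 (dv (dv (u2 c))) = (norm c)\<^sup>2 * nrm2 (dv (dv (u2 1)))" for c
    unfolding nrm2_mult[symmetric]
    by (rule nrm2_cong) (simp only: u2'' sinh_sum_mult mult_1_left mult.left_commute)
  have s: "nrm2 (u1 (l * c)) = (norm c)\<^sup>2 * nrm2 (u1 l)" "nrm2 (u2 (l * c)) = (norm c)\<^sup>2 * nrm2 (u2 l)"
      "nrm2 (th c) = (norm c)\<^sup>2 * nrm2 (th 1)" "nrm2 (q c) = (norm c)\<^sup>2 * nrm2 (q 1)" for c
    by (subst scale1, rule nrm2_mult) (subst scale2, rule nrm2_mult,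
        subst scale3, rule nrm2_mult, subst scale4, rule nrm2_mult)
  define E where
      "E = a1 * nrm2 (dv (u1 1)) + nrm2 (u1 l) + d2 / b2 * (a2 * nrm2 (dv (dv (u2 1))) + nrm2 (u2 l))
            + nrm2 (th 1) + g2 * t2 / k2 * nrm2 (q 1)"
  have "nH (U c) = sqrt ((norm c)\<^sup>2 * E)" for c
    unfolding normH_def U_def prod.case s1[of c] s2[of c] s[of c] E_def
    by (rule arg_cong[of _ _ sqrt]) algebra
  then have nH: "nH (U c) = norm c * sqrt E" for c by (simp add: real_sqrt_mult)
  \<comment> \<open>The third component alone bounds the energy from below: it is l u1, which does
    not vanish at the junction.\<close>
  have "nrm2 (u1 l) > 0"
  proof (rule nrm2_pos[of _ 0])
    show "continuous_on I0 (u1 l)" unfolding u1_def by (rule continuous_sinh_sum)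
  qed (use l wave(2) in \<open>auto simp: u1_def sinh_sum_def\<close>)
  moreover have "E \<ge> nrm2 (u1 l)"
    unfolding E_def using pos nrm2_nonneg by (simp add: add_nonneg_nonneg)
  ultimately have "sqrt E > 0" by simp
  then have "eigen_family l U (sqrt E)"
    using dom nH op lin by (simp add: eigen_family_def)
  then show ?thesis by blast
qed

text \<open>The family is linear in its scalar, so the norm of the difference quotient in the state
  space is \<open>\<nu>\<close> times the modulus of the scalar one, and differentiability of exp (l
  t) finishes the argument.\<close>

lemma classical_sol_exp:
  assumes "eigen_family l U \<nu>"
  shows "classical_sol a1 a2 b2 g2 d2 t2 k2 (\<lambda>t. U (exp (l * of_real t)))"
  unfolding classical_sol_def
proof (intro allI impI conjI)
  fix t :: real assume "t \<ge> 0"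
  show "Dom (U (exp (l * of_real t)))" using assms by (simp add: eigen_family_def)
  let ?e = "\<lambda>t::real. exp (l * of_real t)"
  have "((\<lambda>z. exp (l * z)) has_field_derivative l * ?e t) (at (of_real t))"
    by (auto intro!: derivative_eq_intros)
  then have "((\<lambda>z. (exp (l * z) - ?e t) / (z - of_real t)) \<longlongrightarrow> l * ?e t) (at (of_real t))"
    by (simp add: has_field_derivative_iff)
  moreover have "filterlim of_real (at (complex_of_real t)) (at t within {0..})"
    unfolding filterlim_at by (auto intro!: tendsto_intros simp: eventually_at intro: exI[of _ 1])
  ultimately have "((\<lambda>s. (?e s - ?e t) / (of_real s - of_real t)) \<longlongrightarrow> l * ?e t) (at t within {0..})"
    by (rule filterlim_compose)
  then have "((\<lambda>s. norm ((?e s - ?e t) / (of_real s - of_real t) - l * ?e t) * \<nu>) \<longlongrightarrow>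
      norm (l * ?e t - l * ?e t) * \<nu>) (at t within {0..})"
    by (intro tendsto_intros)
  moreover have "nH (st_lin (of_real (1 / (s - t))) (st_lin 1 (U (?e s)) (-1) (U (?e t))) (-1) (Op
      (U (?e t))))
     = norm ((?e s - ?e t) / (of_real s - of_real t) - l * ?e t) * \<nu>" for s
  proof -
    let ?a = "of_real (1 / (s - t)) :: complex"
    have "state_eq (st_lin ?a (st_lin 1 (U (?e s)) (-1) (U (?e t))) (-1) (Op (U (?e t))))
       (st_lin ?a (U (1 * ?e s + (-1) * ?e t)) (-1) (U (l * ?e t)))"
      using assms unfolding eigen_family_def by (intro state_eq_st_lin) blast+
    moreover have "state_eq \<dots> (U (?a * (1 * ?e s + (-1) * ?e t) + (-1) * (l * ?e t)))"
      using assms unfolding eigen_family_def by blast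
    ultimately have "state_eq (st_lin ?a (st_lin 1 (U (?e s)) (-1) (U (?e t))) (-1) (Op (U (?e t))))
       (U (?a * (1 * ?e s + (-1) * ?e t) + (-1) * (l * ?e t)))" by (rule state_eq_trans)
    then have "nH (st_lin ?a (st_lin 1 (U (?e s)) (-1) (U (?e t))) (-1) (Op (U (?e t))))
      = nH (U (?a * (1 * ?e s + (-1) * ?e t) + (-1) * (l * ?e t)))" by (rule normH_cong)
    also have "\<dots> = norm (?a * (1 * ?e s + (-1) * ?e t) + (-1) * (l * ?e t)) * \<nu>"
      using assms by (simp add: eigen_family_def)
    finally show ?thesis by simp
  qed
  ultimately show "((\<lambda>s. nH (st_lin (of_real (1 / (s - t))) (st_lin 1 (U (?e s)) (-1) (U (?e t)))
                         (-1) (Op (U (?e t))))) \<longlongrightarrow> 0) (at t within {0..})" by simp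
qed

lemma slow_eigenvalues_imp:
  fixes l :: "nat \<Rightarrow> complex"
  assumes ev: "\<forall>\<^sub>F m in sequentially. \<exists>U \<nu>. eigen_family (l m) U \<nu>"
    and lim: "filterlim (\<lambda>m. Im (l m)) at_top sequentially"
    and Re: "\<forall>\<^sub>F m in sequentially. \<bar>Re (l m)\<bar> * Im (l m) \<le> C"
    and C: "C > 0"
  shows "\<not> exp_stable a1 a2 b2 g2 d2 t2 k2"
    and "\<alpha> < 1 \<Longrightarrow>
       Limsup at_infinity (\<lambda>l. ereal (\<bar>l\<bar> powr (- \<alpha>)) * res_norm a1 a2 b2 g2 d2 t2 k2 l) = \<infinity>"
proof -
  show "\<not> exp_stable a1 a2 b2 g2 d2 t2 k2"
  proof
    assume "exp_stable a1 a2 b2 g2 d2 t2 k2"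
    then obtain K w where w: "w > 0" and K': "\<forall>U. classical_sol a1 a2 b2 g2 d2 t2 k2 U \<longrightarrow>
        (\<forall>t\<ge>0. nH (U t) \<le> K * exp (- w * t) * nH (U 0))"
      unfolding exp_stable_def by (elim exE conjE)
    have K: "nH (U t) \<le> K * exp (- w * t) * nH (U 0)"
      if "classical_sol a1 a2 b2 g2 d2 t2 k2 U" "t \<ge> 0" for U t
      by (rule K'[rule_format, OF that])
    \<comment> \<open>Beyond this frequency |Re l| is at most w / 2, half of the assumed decay
      rate.\<close>
    have "\<forall>\<^sub>F m in sequentially. Im (l m) > 2 * C / w"
      using lim by (simp add: filterlim_at_top_dense)
    with ev Re have "\<forall>\<^sub>F m in sequentially. \<exists>U \<nu>. eigen_family (l m) U \<nu> \<and>
        Im (l m) > 2 * C / w \<and> \<bar>Re (l m)\<bar> * Im (l m) \<le> C"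
      by eventually_elim auto
    then obtain m U \<nu> where m: "eigen_family (l m) U \<nu>" "Im (l m) > 2 * C / w" "\<bar>Re (l m)\<bar> * Im (l
        m) \<le> C"
      using eventually_happens'[OF sequentially_bot] by fast
    have "\<bar>Re (l m)\<bar> * (2 * C / w) \<le> \<bar>Re (l m)\<bar> * Im (l m)"
      using m(2) by (intro mult_left_mono) auto
    with m(3) have "\<bar>Re (l m)\<bar> * (2 * C / w) \<le> w / 2 * (2 * C / w)"
      using w by simp
    then have "\<bar>Re (l m)\<bar> \<le> w / 2"
      by (rule mult_right_le_imp_le) (use w C in simp)
    then have "Re (l m) \<ge> - w / 2" by linarith
    have bound: "exp (w / 2 * t) \<le> K" if "t \<ge> 0" for t
    proof -
      have "norm (exp (l m * t)) * \<nu> \<le> K * exp (- w * t) * \<nu>"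
        using K[OF classical_sol_exp[OF m(1)] that] m(1) by (simp add: eigen_family_def)
      then have "exp (Re (l m) * t) \<le> K * exp (- w * t)"
        using m(1) by (simp add: eigen_family_def)
      moreover have "exp (- w / 2 * t) \<le> exp (Re (l m) * t)"
        using \<open>Re (l m) \<ge> - w / 2\<close> that by (intro iffD2[OF exp_le_cancel_iff] mult_right_mono)
      ultimately have "exp (- w / 2 * t) \<le> K * exp (- w * t)" by linarith
      then have "exp (- w / 2 * t) * exp (w * t) \<le> K * exp (- w * t) * exp (w * t)"
        by (rule mult_right_mono) simp
      moreover have "exp (- w / 2 * t) * exp (w * t) = exp (w / 2 * t)"
        unfolding exp_add[symmetric] by (simp add: field_simps)
      moreover have "K * exp (- w * t) * exp (w * t) = K"
        unfolding mult.assoc exp_add[symmetric] by simp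
      ultimately show ?thesis by (simp only:)
    qed
    have "K \<ge> 1" using bound[of 0] by simp
    \<comment> \<open>At time 2 K / w the exponent equals K, and exp K \<le> K is
      impossible.\<close>
    have "w / 2 * (2 * K / w) = K" using w by (simp add: field_simps)
    then have "exp K \<le> K" using bound[of "2 * K / w"] \<open>K \<ge> 1\<close> w by simp
    then show False using exp_ge_add_one_self[of K] by linarith
  qed
  assume \<alpha>: "\<alpha> < 1"
  let ?R = "res_norm a1 a2 b2 g2 d2 t2 k2"
  let ?f = "\<lambda>l::real. ereal (\<bar>l\<bar> powr (- \<alpha>)) * ?R l"
  have "\<forall>\<^sub>F m in sequentially. Im (l m) > 0"
    using lim by (simp add: filterlim_at_top_dense)
  with ev Re have bound: "\<forall>\<^sub>F m in sequentially. ?f (Im (l m)) \<ge> ereal (Im (l m) powr (1 - \<alpha>) / C)"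
  proof eventually_elim
    case (elim m)
    then obtain U \<nu> where U: "eigen_family (l m) U \<nu>" by blast
    then have \<nu>: "\<nu> > 0" by (simp add: eigen_family_def)
    \<comment> \<open>With this scaling \<open>U c\<close> has norm Im l / C and its residual has
      norm |Re l| Im l / C \<le> 1. Scaling by Im l instead of 1 / |Re l| avoids a division by a
      possibly vanishing real part.\<close>
    define c where "c = complex_of_real (Im (l m) / (C * \<nu>))"
    have c: "norm c * \<nu> = Im (l m) / C" using elim(3) C \<nu> by (simp add: c_def norm_divide norm_mult)
    have "nH (st_lin (\<i> * of_real (Im (l m))) (U c) (-1) (Op (U c)))
        = norm ((\<i> * of_real (Im (l m)) - l m) * c) * \<nu>"
      by (subst eigen_family_resolvent[OF U]) (simp add: algebra_simps)
    also have "\<i> * of_real (Im (l m)) - l m = - of_real (Re (l m))"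
      by (simp add: complex_eq_iff)
    also have "norm (- of_real (Re (l m)) * c) * \<nu> = \<bar>Re (l m)\<bar> * (Im (l m) / C)"
      using c by (simp add: norm_mult mult.assoc)
    also have "\<dots> \<le> 1" using elim(2) C by (simp add: field_simps)
    finally have "ereal (nH (U c)) \<le> ?R (Im (l m))"
      using U unfolding res_norm_def eigen_family_def by (intro SUP_upper) auto
    then have "ereal (Im (l m) powr (- \<alpha>)) * ereal (Im (l m) / C) \<le> ?f (Im (l m))"
      using U c elim(3) by (intro ereal_mult_mono) (auto simp: eigen_family_def C less_imp_le)
    moreover have "Im (l m) powr (- \<alpha>) * (Im (l m) / C) = Im (l m) powr (1 - \<alpha>) / C"
      using elim(3) by (simp add: powr_diff powr_minus field_simps)
    ultimately show ?case by (simp only: times_ereal.simps)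
  qed
  have "filterlim (\<lambda>x. inverse C * exp ((1 - \<alpha>) * ln x)) at_top at_top"
    using \<alpha> C by (intro filterlim_tendsto_pos_mult_at_top[OF tendsto_const]
        filterlim_compose[OF exp_at_top] ln_at_top) auto
  moreover have "\<forall>\<^sub>F x in at_top. inverse C * exp ((1 - \<alpha>) * ln x) = x powr (1 - \<alpha>) / C"
    using eventually_gt_at_top[of 0] by eventually_elim (simp add: powr_def field_simps)
  ultimately have "filterlim (\<lambda>x. x powr (1 - \<alpha>) / C) at_top at_top"
    by (rule filterlim_mono_eventually[OF _ order_refl order_refl])
  then have grow: "filterlim (\<lambda>m. Im (l m) powr (1 - \<alpha>) / C) at_top sequentially"
    by (rule filterlim_compose[OF _ lim])
  have inf: "filterlim (\<lambda>m. Im (l m)) at_infinity sequentially"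
    using lim by (rule filterlim_at_top_imp_at_infinity)
  show "Limsup at_infinity ?f = \<infinity>"
  proof (rule ereal_top)
    fix r :: real
    have "\<forall>\<^sub>F m in sequentially. Im (l m) powr (1 - \<alpha>) / C > r"
      using filterlim_at_top_dense[THEN iffD1, OF grow] by blast
    with bound have large: "\<forall>\<^sub>F m in sequentially. ereal r \<le> ?f (Im (l m))"
    proof eventually_elim
      case (elim m)
      have "ereal r \<le> ereal (Im (l m) powr (1 - \<alpha>) / C)" using elim(2) by simp
      also have "\<dots> \<le> ?f (Im (l m))" by (rule elim(1))
      finally show ?case .
    qed
    \<comment> \<open>Every neighbourhood of infinity contains some \<open>Im (l m)\<close> with m
      large, so each supremum in the infimum defining the upper limit is at least r.\<close>
    show "ereal r \<le> Limsup at_infinity ?f"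
      unfolding Limsup_def
    proof (rule INF_greatest)
      fix P :: "real \<Rightarrow> bool" assume "P \<in> {P. eventually P at_infinity}"
      then have "\<forall>\<^sub>F m in sequentially. P (Im (l m))"
        using filterlim_iff[THEN iffD1, OF inf] by blast
      from eventually_happens'[OF sequentially_bot eventually_conj[OF this large]]
      obtain m where m: "P (Im (l m))" "ereal r \<le> ?f (Im (l m))" by (elim exE conjE)
      show "ereal r \<le> (SUP x\<in>{x. P x}. ?f x)"
        by (rule SUP_upper2[where i = "Im (l m)"]) (simp_all only: m mem_Collect_eq)
    qed
  qed
qed

end

section \<open>Asymptotic expansions\<close>

text \<open>The phase 3/4 keeps both junction quantities from degenerating. With phase \<theta> and
  c = cot (pi \<theta>) their leading terms are M (1 - c) for the displacement and -2 c for the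
  flux, so c must avoid 1 and 0; here c = -1.\<close>

definition wnum :: "nat \<Rightarrow> real" where "wnum m = real m + 3 / 4"

abbreviation cwnum :: "nat \<Rightarrow> complex" where "cwnum m \<equiv> of_real (wnum m)"

text \<open>A one-term expansion whose index is the order of the absolute error; a quantity of size
  M^i is therefore divided by M^i first.\<close>

definition approx :: "nat \<Rightarrow> (nat \<Rightarrow> complex) \<Rightarrow> complex \<Rightarrow> bool" where
  "approx j f a \<longleftrightarrow> (\<lambda>m. f m - a) \<in> O(\<lambda>m. 1 / cwnum m ^ j)"

lemma wnum_pos [simp]: "wnum m > 0" "wnum m \<noteq> 0" "wnum m \<ge> 0"
  by (auto simp: wnum_def add_nonneg_pos)

lemma filterlim_wnum: "filterlim wnum at_top sequentially"
  by (rule filterlim_at_top_mono[OF filterlim_real_sequentially]) (simp add: wnum_def)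

lemma inverse_cwnum_tendsto: "j > 0 \<Longrightarrow> (\<lambda>m. 1 / cwnum m ^ j) \<longlonglongrightarrow> 0"
proof -
  assume "j > 0"
  have "(\<lambda>m. inverse (wnum m)) \<longlonglongrightarrow> 0"
    by (rule tendsto_inverse_0_at_top[OF filterlim_wnum])
  then have "(\<lambda>m. complex_of_real (inverse (wnum m)) ^ j) \<longlonglongrightarrow> 0 ^ j"
    by (intro tendsto_intros) (metis of_real_0 tendsto_of_real)
  then show ?thesis using \<open>j > 0\<close> by (simp add: power_inverse field_simps power_0_left)
qed

lemma inverse_cwnum_bigo: "i \<le> j \<Longrightarrow> (\<lambda>m. 1 / cwnum m ^ j) \<in> O(\<lambda>m. 1 / cwnum m ^ i)"
proof -
  assume "i \<le> j"
  have "\<forall>\<^sub>F m in sequentially. wnum m \<ge> 1"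
    using filterlim_wnum by (simp add: filterlim_at_top)
  then show ?thesis
    by (intro bigoI[of _ 1], eventually_elim)
      (use \<open>i \<le> j\<close> in \<open>auto simp: norm_divide norm_power intro!: divide_left_mono power_increasing\<close>)
qed

lemma approx_weaken: "approx j f a \<Longrightarrow> i \<le> j \<Longrightarrow> approx i f a"
  unfolding approx_def using inverse_cwnum_bigo landau_o.big_trans by blast

lemma approx_tendsto:
  assumes "approx j f a" "j > 0"
  shows "f \<longlonglongrightarrow> a"
proof -
  obtain C where "\<forall>\<^sub>F m in sequentially. norm (f m - a) \<le> C * norm (1 / cwnum m ^ j)"
    using assms(1) unfolding approx_def by (elim landau_o.bigE)
  moreover have "(\<lambda>m. C * norm (1 / cwnum m ^ j)) \<longlonglongrightarrow> C * norm (0::complex)"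
    by (intro tendsto_intros inverse_cwnum_tendsto assms)
  ultimately have "(\<lambda>m. f m - a) \<longlonglongrightarrow> 0"
    by (intro Lim_null_comparison[of "\<lambda>m. f m - a" "\<lambda>m. C * norm (1 / cwnum m ^ j)"])
      (simp_all only: norm_zero mult_zero_right)
  then show ?thesis by (simp add: LIM_zero_iff)
qed

lemma approx_cong: "\<forall>\<^sub>F m in sequentially. f m = g m \<Longrightarrow> approx j f a \<longleftrightarrow> approx j g a"
  unfolding approx_def by (intro landau_o.big.in_cong) (auto elim: eventually_mono)

lemma approx_const [simp]: "approx j (\<lambda>_. a) a"
  by (simp add: approx_def)

lemma approx_0_mult: "approx i f 0 \<Longrightarrow> approx j g 0 \<Longrightarrow> approx (i + j) (\<lambda>m. f m * g m) 0"
  unfolding approx_def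
  using landau_o.big.mult[of f sequentially "\<lambda>m. 1 / cwnum m ^ i" g "\<lambda>m. 1 / cwnum m ^ j"]
  by (simp add: power_add)

lemma approx_0_bounded: "approx i f 0 \<Longrightarrow> g \<in> O(\<lambda>_. 1) \<Longrightarrow> approx i (\<lambda>m. f m * g m) 0"
  unfolding approx_def
  using landau_o.big.mult[of f sequentially "\<lambda>m. 1 / cwnum m ^ i" g "\<lambda>_. 1"] by simp

lemma approx_inverse_wnum: "approx j (\<lambda>m. 1 / cwnum m ^ j) 0"
  by (simp add: approx_def)

lemma approx_imp_bounded: "approx j f a \<Longrightarrow> f \<in> O(\<lambda>_. 1)"
proof -
  assume "approx j f a"
  then have "approx 0 f a" by (rule approx_weaken) simp
  then have "(\<lambda>m. f m - a) \<in> O(\<lambda>_. 1)" by (simp add: approx_def)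
  then have "(\<lambda>m. (f m - a) + a) \<in> O(\<lambda>_. 1)" by (rule sum_in_bigo(1)) simp
  then show ?thesis by simp
qed

lemma approx_add: "approx j f a \<Longrightarrow> approx j g b \<Longrightarrow> approx j (\<lambda>m. f m + g m) (a + b)"
  unfolding approx_def using sum_in_bigo(1)[of "\<lambda>m. f m - a" _ _ "\<lambda>m. g m - b"]
  by (simp add: algebra_simps)

lemma approx_diff: "approx j f a \<Longrightarrow> approx j g b \<Longrightarrow> approx j (\<lambda>m. f m - g m) (a - b)"
  unfolding approx_def using sum_in_bigo(2)[of "\<lambda>m. f m - a" _ _ "\<lambda>m. g m - b"]
  by (simp add: algebra_simps)

lemma approx_minus: "approx j f a \<Longrightarrow> approx j (\<lambda>m. - f m) (- a)"
  using approx_diff[of j "\<lambda>_. 0" 0 f a] by simp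

lemma approx_mult:
  assumes "approx j f a" "approx j g b"
  shows "approx j (\<lambda>m. f m * g m) (a * b)"
proof -
  have "approx j (\<lambda>m. f m - a) 0" "approx j (\<lambda>m. g m - b) 0"
    using assms by (simp_all add: approx_def)
  then have "approx j (\<lambda>m. (f m - a) * g m + (g m - b) * a) (0 + 0)"
    by (intro approx_add approx_0_bounded approx_imp_bounded[OF assms(2)]) auto
  then show ?thesis by (simp add: approx_def algebra_simps)
qed

lemma approx_cmult: "approx j f a \<Longrightarrow> approx j (\<lambda>m. c * f m) (c * a)"
  using approx_mult[OF approx_const] .

lemma approx_power: "approx j f a \<Longrightarrow> approx j (\<lambda>m. f m ^ n) (a ^ n)"
  by (induction n) (auto intro: approx_mult)

text \<open>Differentiability at \<open>a\<close> gives the bound |g y - g a| \<le> (|d| + 1) |y -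
  a| near \<open>a\<close>, which is enough to carry the error over.\<close>

lemma approx_compose:
  assumes "approx j f a" "j > 0" "(g has_field_derivative d) (at a)"
  shows "approx j (\<lambda>m. g (f m)) (g a)"
proof -
  have "((\<lambda>y. (g y - g a) / (y - a)) \<longlongrightarrow> d) (at a)"
    using assms(3) by (simp add: has_field_derivative_iff)
  then have "\<forall>\<^sub>F y in at a. norm ((g y - g a) / (y - a)) < norm d + 1"
    by (intro order_tendstoD(2)[OF tendsto_norm]) auto
  then have "\<forall>\<^sub>F y in nhds a. norm (g y - g a) \<le> (norm d + 1) * norm (y - a)"
    unfolding eventually_at_filter
    by eventually_elim (auto simp: norm_divide divide_simps mult.commute split: if_splits)
  then have "\<forall>\<^sub>F m in sequentially. norm (g (f m) - g a) \<le> (norm d + 1) * norm (f m - a)"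
    using filterlim_iff[THEN iffD1, OF approx_tendsto[OF assms(1,2)]] by blast
  then have "(\<lambda>m. g (f m) - g a) \<in> O(\<lambda>m. f m - a)" by (rule bigoI)
  then show ?thesis using assms(1) unfolding approx_def by (rule landau_o.big_trans)
qed

lemma approx_divide:
  assumes "approx j f a" "approx j g b" "b \<noteq> 0" "j > 0"
  shows "approx j (\<lambda>m. f m / g m) (a / b)"
proof -
  have "(inverse has_field_derivative - (inverse b * inverse b)) (at b)"
    using DERIV_inverse'[OF DERIV_ident, of b UNIV] assms(3) by simp
  from approx_mult[OF assms(1) approx_compose[OF assms(2,4) this]]
  show ?thesis by (simp add: divide_inverse)
qed

lemma approx_csqrt:
  assumes "approx j f a" "j > 0" "a \<notin> \<real>\<^sub>\<le>\<^sub>0"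
  shows "approx j (\<lambda>m. csqrt (f m)) (csqrt a)"
  using approx_compose[OF assms(1,2) has_field_derivative_csqrt[OF assms(3)]] .

lemma approx_Ln:
  assumes "approx j f a" "j > 0" "a \<notin> \<real>\<^sub>\<le>\<^sub>0"
  shows "approx j (\<lambda>m. Ln (f m)) (Ln a)"
  using approx_compose[OF assms(1,2) has_field_derivative_Ln[OF assms(3)]] .

lemma approx_eventually_neq: "approx j f a \<Longrightarrow> j > 0 \<Longrightarrow> a \<noteq> b \<Longrightarrow> \<forall>\<^sub>F m in sequentially. f m \<noteq> b"
  using approx_tendsto tendsto_imp_eventually_ne by blast

lemma approx_eventually_Re_pos:
  assumes "approx j f a" "j > 0" "Re a > 0"
  shows "\<forall>\<^sub>F m in sequentially. Re (f m) > 0"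
  using order_tendstoD(1)[OF tendsto_Re[OF approx_tendsto[OF assms(1,2)]] assms(3)] .

lemma csqrt_scale:
  assumes "r > 0"
  shows "csqrt (of_real (r\<^sup>2) * z) = of_real r * csqrt z"
proof (rule csqrt_unique)
  show "(of_real r * csqrt z)\<^sup>2 = of_real (r\<^sup>2) * z" by (simp add: power_mult_distrib)
  show "0 < Re (of_real r * csqrt z) \<or> Re (of_real r * csqrt z) = 0 \<and> 0 \<le> Im (of_real r * csqrt z)"
    using csqrt_principal[of z] assms by auto
qed

text \<open>Only exp (-2 w) occurs, which stays bounded for Re w \<ge> 0 while sinh and cosh
  themselves may grow exponentially.\<close>

lemma coth_exp: "cosh w / sinh w = (1 + exp (-2 * w)) / (1 - exp (-2 * (w::complex)))"
proof -
  have "exp (-2 * w) = exp (- w) * exp (- w)" by (simp flip: exp_add)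
  then have "(1 + exp (-2 * w)) * exp w = exp w + exp (- w)" "(1 - exp (-2 * w)) * exp w = exp w -
      exp (- w)"
    by (simp_all add: algebra_simps exp_minus)
  then have "(1 + exp (-2 * w)) / (1 - exp (-2 * w)) = (exp w + exp (- w)) / (exp w - exp (- w))"
    by (metis exp_not_eq_zero mult_divide_mult_cancel_right)
  moreover have "(a / 2) / (b / 2) = a / b" for a b :: complex by simp
  ultimately show ?thesis unfolding cosh_field_def sinh_field_def by (simp only:)
qed

text \<open>In each set a counterexample is chosen whenever there is one; the hypothesis for this
  single sequence excludes counterexamples for large m. Asymptotics along sequences thus become
  uniform.\<close>

lemma eventually_Ball_if_sequences:
  assumes "\<And>m. S m \<noteq> {}"
    and "\<And>x. (\<And>m. x m \<in> S m) \<Longrightarrow> \<forall>\<^sub>F m in sequentially. P m (x m)"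
  shows "\<forall>\<^sub>F m in sequentially. \<forall>x\<in>S m. P m x"
proof -
  have "\<exists>y. y \<in> S m \<and> (P m y \<longrightarrow> (\<forall>x\<in>S m. P m x))" for m
    using assms(1)[of m] by blast
  then obtain x where x: "\<And>m. x m \<in> S m \<and> (P m (x m) \<longrightarrow> (\<forall>x\<in>S m. P m x))" by metis
  have "\<forall>\<^sub>F m in sequentially. P m (x m)" using x by (intro assms(2)) blast
  then show ?thesis by (rule eventually_mono) (use x in blast)
qed

lemma approx_eqI: "(\<And>m. f m = g m) \<Longrightarrow> a = b \<Longrightarrow> approx j g b \<Longrightarrow> approx j f a"
  by (metis ext)

lemma approx_wnum_mult:
  assumes "approx (Suc j) f 0"
  shows "approx j (\<lambda>m. cwnum m * f m) 0"
proof -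
  have "(\<lambda>m. cwnum m * f m) \<in> O(\<lambda>m. cwnum m * (1 / cwnum m ^ Suc j))"
    using assms unfolding approx_def by (intro landau_o.big.mult_left) simp
  then show ?thesis by (simp add: approx_def)
qed

lemma Re_pos_not_nonpos: "Re z > 0 \<Longrightarrow> z \<notin> \<real>\<^sub>\<le>\<^sub>0"
  by (auto simp: complex_nonpos_Reals_iff)

section \<open>The characteristic equation\<close>

context plate_wave
begin

definition beta :: real where "beta = a2 + b2 * d2"
definition root_beta :: real where "root_beta = sqrt beta"
definition wave_speed :: real where "wave_speed = sqrt a1"
definition sigma :: "complex \<Rightarrow> complex" where "sigma l = of_real (g2 * k2) / (1 + of_real t2 * l)"

text \<open>The square of a plate wave number is \<open>l z\<close>, where \<open>z\<close> is a root of
  \<open>1 - sigma z + beta z\<^sup>2 - sigma a2 z\<^sup>3\<close>. The maps \<open>root_map1\<close> and \<open>root_map2\<close> have as fixed points the two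
  roots near \<open>\<plusminus>\<i> / sqrt beta\<close>; the third root is \<open>1 / (sigma z)\<close> for a fixed point \<open>z\<close> of \<open>root_map3\<close>.\<close>

definition radicand :: "complex \<Rightarrow> complex \<Rightarrow> complex" where
  "radicand l z = 1 - sigma l * z - sigma l * of_real a2 * z ^ 3"
definition root_map1 :: "complex \<Rightarrow> complex \<Rightarrow> complex" where
  "root_map1 l z = \<i> / of_real root_beta * csqrt (radicand l z)"
definition root_map2 :: "complex \<Rightarrow> complex \<Rightarrow> complex" where
  "root_map2 l z = - (\<i> / of_real root_beta) * csqrt (radicand l z)"
definition root_map3 :: "complex \<Rightarrow> complex \<Rightarrow> complex" where
  "root_map3 l z = (of_real a2 + sigma l ^ 2 * (z ^ 2 - z ^ 3)) / of_real beta"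
text \<open>The quotient k^2 / l^2 for the third wave number. It tends to a positive number, whereas
  k^2 is close to the negative axis, the cut of \<open>csqrt\<close>; hence l stands outside the
  root in \<open>wave_num3\<close>.\<close>

definition sq_ratio3 :: "complex \<Rightarrow> complex \<Rightarrow> complex" where
  "sq_ratio3 l z = (1 + of_real t2 * l) / (l * of_real (g2 * k2) * root_map3 l z)"
text \<open>Here l times the root is close to - M^2, near the cut of \<open>csqrt\<close>, so the
  sign is taken out as the factor \<i>.\<close>

definition wave_num1 :: "complex \<Rightarrow> complex \<Rightarrow> complex" where
  "wave_num1 l z = \<i> * csqrt (- (l * root_map1 l z))"
definition wave_num2 :: "complex \<Rightarrow> complex \<Rightarrow> complex" where "wave_num2 l z = csqrt (l * root_map2 l z)"
definition wave_num3 :: "complex \<Rightarrow> complex \<Rightarrow> complex" where "wave_num3 l z = l * csqrt (sq_ratio3 l z)"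

text \<open>\<open>coth_wave_num k\<close> is \<open>k coth (k pi)\<close>. The amplitudes are the cross product of the vectors of
  the \<open>coth_wave_num\<close> and of the \<open>heat_ratio\<close>, which encode \<open>u2' (0) = 0\<close> and \<open>\<theta> (0) = 0\<close>; it is divided by its
  dominant factor, the third \<open>heat_ratio\<close>.\<close>

definition exp_wave_num :: "complex \<Rightarrow> complex" where "exp_wave_num k = exp (-2 * (k * of_real pi))"
definition coth_wave_num :: "complex \<Rightarrow> complex" where
  "coth_wave_num k = k * ((1 + exp_wave_num k) / (1 - exp_wave_num k))"
definition heat_ratio :: "complex \<Rightarrow> complex \<Rightarrow> complex" where
  "heat_ratio l k = l\<^sup>2 / k\<^sup>2 + of_real a2 * k\<^sup>2"
definition plate_amp1 :: "complex \<Rightarrow> complex \<Rightarrow> complex \<Rightarrow> complex \<Rightarrow> complex" where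
  "plate_amp1 l p q k = coth_wave_num q - coth_wave_num k * heat_ratio l q / heat_ratio l k"
definition plate_amp2 :: "complex \<Rightarrow> complex \<Rightarrow> complex \<Rightarrow> complex \<Rightarrow> complex" where
  "plate_amp2 l p q k = coth_wave_num k * heat_ratio l p / heat_ratio l k - coth_wave_num p"
definition plate_amp3 :: "complex \<Rightarrow> complex \<Rightarrow> complex \<Rightarrow> complex \<Rightarrow> complex" where
  "plate_amp3 l p q k = (coth_wave_num p * heat_ratio l q - coth_wave_num q * heat_ratio l p) /
      heat_ratio l k"
text \<open>For the chosen amplitudes \<open>junction_value\<close> is u2(0) and
  \<open>junction_flux\<close> is (a2 u2'' - b2 \<theta>)'(0) / l^2. Dividing the two junction
  conditions eliminates the wave amplitude and leaves \<open>tanh_value\<close> as the required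
  value of tanh (l pi / wave_speed).\<close>

definition junction_value :: "complex \<Rightarrow> complex \<Rightarrow> complex \<Rightarrow> complex \<Rightarrow> complex" where
  "junction_value l p q k = plate_amp1 l p q k + plate_amp2 l p q k + plate_amp3 l p q k"
definition junction_flux :: "complex \<Rightarrow> complex \<Rightarrow> complex \<Rightarrow> complex \<Rightarrow> complex" where
  "junction_flux l p q k = coth_wave_num p * plate_amp1 l p q k / p\<^sup>2 + coth_wave_num q *
      plate_amp2 l p q k / q\<^sup>2 + coth_wave_num k * plate_amp3 l p q k / k\<^sup>2"
definition tanh_value :: "complex \<Rightarrow> complex \<Rightarrow> complex \<Rightarrow> complex \<Rightarrow> complex" where
  "tanh_value l p q k = - of_real (b2 * wave_speed / d2) * junction_value l p q k / (l *
      junction_flux l p q k)"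
definition tanh_of_roots :: "complex \<Rightarrow> complex \<Rightarrow> complex \<Rightarrow> complex \<Rightarrow> complex" where
  "tanh_of_roots l z1 z2 z3 = tanh_value l (wave_num1 l z1) (wave_num2 l z2) (wave_num3 l z3)"
text \<open>A frequency of the undamped wave with Dirichlet conditions at both ends, rounded down
  from \<open>root_beta\<close> M^2; the rounding error is bounded, hence negligible against
  M^2.\<close>

definition centre :: "nat \<Rightarrow> real" where
  "centre m = wave_speed * of_int \<lfloor>root_beta * (wnum m)\<^sup>2 / wave_speed\<rfloor>"

lemma parameters_pos: "beta > 0" "root_beta > 0" "wave_speed > 0" "root_beta\<^sup>2 = beta"
    "wave_speed\<^sup>2 = a1"
  using pos by (auto simp: beta_def root_beta_def wave_speed_def add_pos_pos)

lemma centre_bound: "\<bar>centre m - root_beta * (wnum m)\<^sup>2\<bar> \<le> wave_speed"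
proof -
  let ?x = "root_beta * (wnum m)\<^sup>2 / wave_speed"
  have "\<bar>of_int \<lfloor>?x\<rfloor> - ?x\<bar> \<le> 1" by linarith
  then have "wave_speed * \<bar>of_int \<lfloor>?x\<rfloor> - ?x\<bar> \<le> wave_speed * 1" using parameters_pos by (intro
      mult_left_mono) auto
  moreover have "centre m - root_beta * (wnum m)\<^sup>2 = wave_speed * (of_int \<lfloor>?x\<rfloor> - ?x)"
    using parameters_pos by (simp add: centre_def right_diff_distrib)
  ultimately show ?thesis using parameters_pos by (simp add: abs_mult)
qed

text \<open>Two kinds of conditions are collected. Positive real parts and nonzero denominators keep
  roots and logarithm off their cuts and make the fixed-point map continuous; the nonvanishing
  junction quantities make a fixed point yield an eigenvector.\<close>

definition nondegenerate :: "complex \<Rightarrow> complex \<Rightarrow> complex \<Rightarrow> complex \<Rightarrow> bool" where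
  "nondegenerate l z1 z2 z3 \<longleftrightarrow> l \<noteq> 0 \<and> 1 + of_real t2 * l \<noteq> 0 \<and> Re (radicand l z1) > 0 \<and> Re
      (radicand l z2) > 0 \<and>
     Re (- (l * root_map1 l z1)) > 0 \<and> Re (l * root_map2 l z2) > 0 \<and> root_map3 l z3 \<noteq> 0 \<and> Re
         (sq_ratio3 l z3) > 0 \<and>
     exp_wave_num (wave_num1 l z1) \<noteq> 1 \<and> exp_wave_num (wave_num2 l z2) \<noteq> 1 \<and> exp_wave_num
         (wave_num3 l z3) \<noteq> 1 \<and> heat_ratio l (wave_num3 l z3) \<noteq> 0 \<and>
     junction_flux l (wave_num1 l z1) (wave_num2 l z2) (wave_num3 l z3) \<noteq> 0 \<and> junction_value l
         (wave_num1 l z1) (wave_num2 l z2) (wave_num3 l z3) \<noteq> 0 \<and>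
     tanh_of_roots l z1 z2 z3 \<noteq> 1 \<and> tanh_of_roots l z1 z2 z3 \<noteq> - 1 \<and> Re ((1 + tanh_of_roots l z1
         z2 z3) / (1 - tanh_of_roots l z1 z2 z3)) > 0"

end

text \<open>The hyperbolic cotangent at the third wave number is controlled through the real part of that
  number, which is asymptotically a positive multiple of \<open>Re l + 1 / (2 t2)\<close>; this is why \<open>l\<close> is confined
  to balls of radius tending to 0.\<close>

locale plate_wave_seq = plate_wave +
  fixes lam z1 z2 z3 :: "nat \<Rightarrow> complex" and R :: real
  assumes lam: "\<And>m. norm (lam m - \<i> * centre m) \<le> 1 / sqrt (wnum m)"
    and z: "\<And>m. norm (z1 m) \<le> R" "\<And>m. norm (z2 m) \<le> R" "\<And>m. norm (z3 m) \<le> R"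
begin

lemma inverse_wnum_sq: "approx 2 (\<lambda>m. 1 / cwnum m ^ 2) 0" by (rule approx_inverse_wnum)
lemma inverse_wnum: "approx 1 (\<lambda>m. 1 / cwnum m) 0" using approx_inverse_wnum[of 1] by simp

lemma z_bounded: "z1 \<in> O(\<lambda>_. 1)" "z2 \<in> O(\<lambda>_. 1)" "z3 \<in> O(\<lambda>_. 1)"
  using z by (auto intro!: bigoI[of _ R])

lemma lam_cen: "(\<lambda>m. lam m - \<i> * centre m) \<longlonglongrightarrow> 0"
proof (rule Lim_null_comparison)
  show "\<forall>\<^sub>F m in sequentially. norm (lam m - \<i> * centre m) \<le> inverse (sqrt (wnum m))"
    using lam by (simp add: field_simps)
  show "(\<lambda>m. inverse (sqrt (wnum m))) \<longlonglongrightarrow> 0"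
    by (intro tendsto_inverse_0_at_top filterlim_compose[OF sqrt_at_top filterlim_wnum])
qed

lemma Re_lam: "(\<lambda>m. Re (lam m)) \<longlonglongrightarrow> 0"
  using tendsto_Re[OF lam_cen] by simp

lemma lam_W: "approx 2 (\<lambda>m. lam m / cwnum m ^ 2) (\<i> * root_beta)"
proof -
  have "norm ((lam m - \<i> * centre m) + \<i> * (centre m - root_beta * (wnum m)\<^sup>2)) \<le> (2 + wave_speed)
      * norm (1::complex)" for m
  proof -
    \<comment> \<open>The crude bound \<open>wnum m\<close> \<ge> 1/4 gives radius at most 2; only
      boundedness against M^2 matters.\<close>
    have "1 / sqrt (wnum m) \<le> 1 / sqrt (1/4)"
      by (intro divide_left_mono real_sqrt_le_mono) (auto simp: wnum_def)
    then have "norm (lam m - \<i> * centre m) \<le> 2" using lam[of m] by (simp add: real_sqrt_divide)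
    moreover have "norm (\<i> * (centre m - root_beta * (wnum m)\<^sup>2)) \<le> wave_speed"
      using centre_bound[of m] by (simp only: norm_mult norm_ii norm_of_real mult_1_left)
    ultimately show ?thesis by (intro order_trans[OF norm_triangle_ineq]) simp
  qed
  then have "(\<lambda>m. (lam m - \<i> * centre m) + \<i> * (centre m - root_beta * (wnum m)\<^sup>2)) \<in> O(\<lambda>_. 1)"
    by (intro bigoI[of _ "2 + wave_speed"] always_eventually allI)
  from approx_0_bounded[OF inverse_wnum_sq this] show ?thesis
    unfolding approx_def by (rule landau_o.big.ev_eq_trans2[rotated]) (simp add: field_simps)
qed

lemma inverse_lam: "approx 2 (\<lambda>m. 1 / lam m) 0"
  by (rule approx_eqI[OF _ _ approx_divide[OF inverse_wnum_sq lam_W]]) (use parameters_pos in auto)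

lemma sigma: "approx 2 (\<lambda>m. sigma (lam m)) 0"
proof -
  have "t2 * (\<i> * root_beta) \<noteq> 0" using pos parameters_pos by simp
  then have "approx 2 (\<lambda>m. of_real (g2 * k2) * (1 / cwnum m ^ 2) / (1 / cwnum m ^ 2 + t2 * (lam m
      / cwnum m ^ 2)))
      (of_real (g2 * k2) * 0 / (0 + t2 * (\<i> * root_beta)))"
    by (intro approx_divide[OF approx_cmult[OF inverse_wnum_sq] approx_add[OF inverse_wnum_sq
        approx_cmult[OF lam_W]]]) simp_all
  then show ?thesis
    by (rule approx_eqI[rotated 2]) (simp_all add: sigma_def add_divide_distrib[symmetric])
qed

lemma radicand: "approx 2 (\<lambda>m. radicand (lam m) (z1 m)) 1" "approx 2 (\<lambda>m. radicand (lam m) (z2 m)) 1"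
proof -
  have "approx 2 (\<lambda>m. radicand (lam m) (z m)) (1 - 0 - 0)" if z: "z \<in> O(\<lambda>_. 1)" for z
  proof -
    have "(\<lambda>m. a2 * z m ^ 3) \<in> O(\<lambda>_. 1)"
      using landau_o.big_power[OF z, of 3] by simp
    from approx_0_bounded[OF sigma this] approx_0_bounded[OF sigma z] show ?thesis
      unfolding radicand_def mult.assoc by (intro approx_diff approx_const)
  qed
  from this[OF z_bounded(1)] this[OF z_bounded(2)]
  show "approx 2 (\<lambda>m. radicand (lam m) (z1 m)) 1" "approx 2 (\<lambda>m. radicand (lam m) (z2 m)) 1" by simp_all
qed

lemma root_map1: "approx 2 (\<lambda>m. root_map1 (lam m) (z1 m)) (\<i> / root_beta)"
  unfolding root_map1_def
  by (rule approx_eqI[OF refl _ approx_cmult[OF approx_csqrt[OF radicand(1)]]]) auto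

lemma root_map2: "approx 2 (\<lambda>m. root_map2 (lam m) (z2 m)) (- (\<i> / root_beta))"
  unfolding root_map2_def
  by (rule approx_eqI[OF refl _ approx_cmult[OF approx_csqrt[OF radicand(2)]]]) auto

text \<open>The order is 4 because \<open>sigma\<close> enters squared. The real part of the third
  wave number depends on it: an error of order 2 would be as large as the term that produces this
  real part.\<close>

lemma root_map3: "approx 4 (\<lambda>m. root_map3 (lam m) (z3 m)) (a2 / beta)"
proof -
  have "(\<lambda>m. z3 m ^ 2 - z3 m ^ 3) \<in> O(\<lambda>_. 1)"
    using landau_o.big_power[OF z_bounded(3), of 2] landau_o.big_power[OF z_bounded(3), of 3]
    by (intro sum_in_bigo) simp_all
  moreover have "approx 4 (\<lambda>m. sigma (lam m) ^ 2) 0"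
    using approx_0_mult[OF sigma sigma] by (simp add: power2_eq_square)
  ultimately have "approx 4 (\<lambda>m. sigma (lam m) ^ 2 * (z3 m ^ 2 - z3 m ^ 3)) 0"
    by (intro approx_0_bounded)
  from approx_cmult[OF approx_add[OF approx_const this], of "1 / beta" a2] show ?thesis
    by (rule approx_eqI[rotated 2]) (simp_all add: root_map3_def)
qed

section \<open>Expansions of the plate wave numbers\<close>

definition "K1 m = wave_num1 (lam m) (z1 m)"
definition "K2 m = wave_num2 (lam m) (z2 m)"
definition "K3 m = wave_num3 (lam m) (z3 m)"

lemma arg1: "approx 2 (\<lambda>m. - (lam m * root_map1 (lam m) (z1 m)) / cwnum m ^ 2) 1"
  by (rule approx_eqI[OF _ _ approx_minus[OF approx_mult[OF lam_W root_map1]]])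
    (use parameters_pos in \<open>auto simp: field_simps\<close>)

lemma arg2: "approx 2 (\<lambda>m. lam m * root_map2 (lam m) (z2 m) / cwnum m ^ 2) 1"
  by (rule approx_eqI[OF _ _ approx_mult[OF lam_W root_map2]])
    (use parameters_pos in \<open>auto simp: field_simps\<close>)

lemma csqrt_wnum: "csqrt (w / cwnum m ^ 2) = csqrt w / cwnum m"
  using csqrt_scale[of "wnum m" "w / cwnum m ^ 2"] by (simp add: field_simps)

lemma K1: "approx 2 (\<lambda>m. K1 m / cwnum m) \<i>"
  by (rule approx_eqI[OF _ _ approx_cmult[of _ _ _ \<i>, OF approx_csqrt[OF arg1]]])
    (simp_all only: K1_def wave_num1_def csqrt_wnum times_divide_eq_right csqrt_1 mult_1_right, auto)

lemma K2: "approx 2 (\<lambda>m. K2 m / cwnum m) 1"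
  by (rule approx_eqI[OF _ _ approx_csqrt[OF arg2]]) (auto simp: K2_def wave_num2_def csqrt_wnum)

lemma K1_sq: "approx 2 (\<lambda>m. (K1 m)\<^sup>2 / cwnum m ^ 2) (-1)"
  using approx_power[OF K1, of 2] by (simp add: power_divide)

lemma K2_sq: "approx 2 (\<lambda>m. (K2 m)\<^sup>2 / cwnum m ^ 2) 1"
  using approx_power[OF K2, of 2] by (simp add: power_divide)

text \<open>The limit of \<open>K3 m / lam m\<close>, the reciprocal of the high-frequency speed of
  the heat wave.\<close>

definition "thermal_slope = sqrt (t2 * beta / (g2 * k2 * a2))"

lemma thermal_slope: "thermal_slope > 0" "thermal_slope\<^sup>2 = t2 * beta / (g2 * k2 * a2)"
  using pos parameters_pos by (auto simp: thermal_slope_def)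

definition "thermal_ratio m = of_real t2 / (of_real (g2 * k2) * root_map3 (lam m) (z3 m))"

lemma thermal_ratio: "approx 4 thermal_ratio (thermal_slope\<^sup>2)"
proof -
  have "approx 4 thermal_ratio (of_real t2 / (of_real (g2 * k2) * of_real (a2 / beta)))"
    using pos parameters_pos unfolding thermal_ratio_def
    by (intro approx_divide[OF approx_const approx_cmult[OF root_map3]]) auto
  also have "of_real t2 / (of_real (g2 * k2) * of_real (a2 / beta)) = complex_of_real (thermal_slope\<^sup>2)"
    unfolding thermal_slope(2) using pos parameters_pos by simp
  finally show ?thesis .
qed

lemma sq_ratio3_eq: "lam m \<noteq> 0 \<Longrightarrow> sq_ratio3 (lam m) (z3 m) = thermal_ratio m * (1 + 1 / t2 * (1 /
    lam m))"
  using pos by (cases "root_map3 (lam m) (z3 m) = 0") (auto simp: sq_ratio3_def thermal_ratio_def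
      field_simps)

lemma lam_nonzero: "\<forall>\<^sub>F m in sequentially. lam m \<noteq> 0"
  using approx_eventually_neq[OF lam_W, of 0] parameters_pos by (auto elim: eventually_mono)

lemma sq_ratio3: "approx 2 (\<lambda>m. sq_ratio3 (lam m) (z3 m)) (thermal_slope\<^sup>2)"
proof -
  have "approx 2 (\<lambda>m. thermal_ratio m * (1 + of_real (1 / t2) * (1 / lam m))) (of_real
      (thermal_slope\<^sup>2) * (1 + of_real (1 / t2) * 0))"
    by (rule approx_mult[OF approx_weaken[OF thermal_ratio] approx_add[OF approx_const
        approx_cmult[OF inverse_lam]]]) simp
  moreover have "\<forall>\<^sub>F m in sequentially. sq_ratio3 (lam m) (z3 m) = thermal_ratio m * (1 + 1 / t2 *
      (1 / lam m))"
    using lam_nonzero by eventually_elim (rule sq_ratio3_eq)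
  ultimately show ?thesis by (subst approx_cong) auto
qed

lemma K3: "approx 2 (\<lambda>m. K3 m / cwnum m ^ 2) (\<i> * root_beta * thermal_slope)"
proof -
  have "csqrt (complex_of_real (thermal_slope\<^sup>2)) = thermal_slope"
    by (subst of_real_power, rule csqrt_square) (use thermal_slope(1) in auto)
  moreover have "complex_of_real (thermal_slope\<^sup>2) \<notin> \<real>\<^sub>\<le>\<^sub>0" using thermal_slope(1) by (intro
      Re_pos_not_nonpos) simp
  ultimately show ?thesis
    using approx_mult[OF lam_W approx_csqrt[OF sq_ratio3]] by (simp add: K3_def wave_num3_def
        mult.assoc)
qed

lemma K3_sq: "approx 2 (\<lambda>m. (K3 m)\<^sup>2 / cwnum m ^ 4) (- (root_beta\<^sup>2 * thermal_slope\<^sup>2))"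
  using approx_power[OF K3, of 2] by (simp add: power_divide power_mult_distrib flip: power_mult)

text \<open>The real part of the third wave number is only the second term of its expansion; it is
  isolated by completing the square.\<close>

lemma Re_K3: "(\<lambda>m. Re (K3 m)) \<longlonglongrightarrow> thermal_slope / (2 * t2)"
proof -
  \<comment> \<open>With h = l + 1 / (2 t2) one has l^2 + l / t2 = h^2 - 1 / (4 t2^2). Hence K3^2 -
    (\<open>thermal_slope\<close> h)^2 is bounded, and division by the sum
    \<open>K3 m + thermal_slope * h m\<close>, of size M^2, shows that the difference
    \<open>V\<close> tends to 0.\<close>
  define h where "h m = lam m + 1 / (2 * t2)" for m
  define V where "V m = K3 m - thermal_slope * h m" for m
  define L where "L m = lam m / cwnum m ^ 2" for m
  define P where "P m = (K3 m + thermal_slope * h m) / cwnum m ^ 2" for m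
  have L: "approx 2 L (\<i> * root_beta)" unfolding L_def by (rule lam_W)
  have h: "approx 2 (\<lambda>m. h m / cwnum m ^ 2) (\<i> * root_beta)"
    using approx_add[OF lam_W approx_cmult[OF inverse_wnum_sq, of "1 / (2 * t2)"]]
    by (simp add: h_def add_divide_distrib)
  have P: "approx 2 P (\<i> * root_beta * thermal_slope + thermal_slope * (\<i> * root_beta))"
    using approx_add[OF K3 approx_cmult[OF h, of thermal_slope]]
    by (rule approx_eqI[rotated 2]) (simp_all add: P_def add_divide_distrib)
  have "(\<lambda>m. (L m)\<^sup>2 + 1 / t2 * (L m * (1 / cwnum m ^ 2))) \<in> O(\<lambda>_. 1)"
    by (rule approx_imp_bounded[OF approx_add[OF approx_power[OF L] approx_cmult[OF approx_mult[OF
        L inverse_wnum_sq]]]])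
  moreover have "approx 4 (\<lambda>m. thermal_ratio m - thermal_slope\<^sup>2) 0" using thermal_ratio by (simp
      add: approx_def)
  ultimately have "approx 4 (\<lambda>m. (thermal_ratio m - thermal_slope\<^sup>2) * ((L m)\<^sup>2 + 1 / t2 * (L m *
      (1 / cwnum m ^ 2)))) 0"
    by (intro approx_0_bounded)
  then have "approx (Suc (Suc 2)) (\<lambda>m. (thermal_ratio m - thermal_slope\<^sup>2) * ((L m)\<^sup>2 + 1 / t2 *
      (L m * (1 / cwnum m ^ 2)))) 0"
    by (simp add: numeral_eq_Suc)
  then have "approx 2 (\<lambda>m. cwnum m * (cwnum m * ((thermal_ratio m - thermal_slope\<^sup>2) * ((L m)\<^sup>2 +
      1 / t2 * (L m * (1 / cwnum m ^ 2))))))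
      0" (is "approx 2 ?F 0")
    by (intro approx_wnum_mult)
  moreover have "\<i> * root_beta * thermal_slope + thermal_slope * (\<i> * root_beta) \<noteq> 0" using
      parameters_pos(2) thermal_slope(1) by simp
  ultimately have "approx 2 (\<lambda>m. (?F m - thermal_slope\<^sup>2 / (4 * t2\<^sup>2) * (1 / cwnum m ^ 2)) / P m)
      ((0 - of_real (thermal_slope\<^sup>2 / (4 * t2\<^sup>2)) * 0) / (\<i> * root_beta * thermal_slope +
          thermal_slope * (\<i> * root_beta)))" (is "approx 2 ?H _")
    by (intro approx_divide[OF approx_diff[OF _ approx_cmult[OF inverse_wnum_sq]] P]) simp_all
  then have "approx 2 ?H 0" by simp
  moreover have "\<forall>\<^sub>F m in sequentially. P m \<noteq> 0"
    by (rule approx_eventually_neq[OF P]) (use parameters_pos(2) thermal_slope(1) in simp_all)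
  with lam_nonzero have "\<forall>\<^sub>F m in sequentially. V m = ?H m"
  proof eventually_elim
    case (elim m)
    have "(K3 m)\<^sup>2 = (lam m)\<^sup>2 * (thermal_ratio m * (1 + 1 / t2 * (1 / lam m)))"
      using elim(1) by (simp add: K3_def wave_num3_def power_mult_distrib sq_ratio3_eq)
    also have "\<dots> = thermal_ratio m * ((lam m)\<^sup>2 + lam m / t2)"
      using elim(1) pos by (simp add: field_simps power2_eq_square)
    finally have "(K3 m)\<^sup>2 - (thermal_slope * h m)\<^sup>2 = (thermal_ratio m - thermal_slope\<^sup>2) * ((lam
        m)\<^sup>2 + lam m / t2) - thermal_slope\<^sup>2 / (4 * t2\<^sup>2)"
      using pos by (simp add: h_def field_simps power2_eq_square)
    moreover have "(K3 m)\<^sup>2 - (thermal_slope * h m)\<^sup>2 = V m * P m * cwnum m ^ 2"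
    proof -
      have "P m * cwnum m ^ 2 = K3 m + thermal_slope * h m" by (simp add: P_def)
      then show ?thesis by (simp only: mult.assoc) (simp add: V_def algebra_simps power2_eq_square)
    qed
    moreover have "(lam m)\<^sup>2 + lam m / t2 = cwnum m ^ 4 * ((L m)\<^sup>2 + 1 / t2 * (L m * (1 / cwnum m
        ^ 2)))"
      by (simp add: L_def field_simps power2_eq_square power4_eq_xxxx)
    ultimately have "V m * P m * cwnum m ^ 2 = cwnum m ^ 2 * (?F m - thermal_slope\<^sup>2 / (4 * t2\<^sup>2)
        * (1 / cwnum m ^ 2))"
      by (simp add: right_diff_distrib power2_eq_square power4_eq_xxxx mult_ac)
    then have "V m * P m = ?F m - thermal_slope\<^sup>2 / (4 * t2\<^sup>2) * (1 / cwnum m ^ 2)"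
      by (simp del: of_real_power)
    then show ?case using elim(2) by (metis nonzero_mult_div_cancel_right)
  qed
  ultimately have "approx 2 V 0" by (subst approx_cong) auto
  then have V: "V \<longlonglongrightarrow> 0" by (rule approx_tendsto) simp
  have "(\<lambda>m. Re (V m)) \<longlonglongrightarrow> Re 0" by (rule tendsto_Re[OF V])
  then have "(\<lambda>m. Re (V m) + thermal_slope * (Re (lam m) + 1 / (2 * t2))) \<longlonglongrightarrow> Re 0 + thermal_slope *
      (0 + 1 / (2 * t2))"
    by (intro tendsto_add[OF _ tendsto_mult[OF tendsto_const tendsto_add[OF Re_lam tendsto_const]]])
  moreover have "Re (V m) + thermal_slope * (Re (lam m) + 1 / (2 * t2)) = Re (K3 m)" for m
    by (simp add: V_def h_def complex_eq_iff Re_divide power2_eq_square)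
  ultimately show ?thesis by simp
qed

text \<open>K1 equals \<i> M up to u = O(1 / M), and exp (-2 pi \<i> (m + 3/4)) = exp (-3 pi \<i> /
  2) = \<i>, away from the value 1 that belongs to the poles of coth.\<close>

lemma exp_wave_num1: "approx 1 (\<lambda>m. exp_wave_num (K1 m)) \<i>"
proof -
  define u where "u m = cwnum m * (K1 m / cwnum m - \<i>)" for m
  have u: "approx 1 u 0"
    unfolding u_def using K1 by (intro approx_wnum_mult) (simp add: approx_def numeral_2_eq_2)
  have "((\<lambda>z. exp (-2 * (z * of_real pi))) has_field_derivative
      exp (-2 * (0 * of_real pi)) * (-2 * of_real pi)) (at 0)"
    by (auto intro!: derivative_eq_intros)
  from approx_cmult[OF approx_compose[OF u _ this], of \<i>]
  have "approx 1 (\<lambda>m. \<i> * exp (-2 * (u m * of_real pi))) \<i>" by simp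
  moreover have "exp_wave_num (K1 m) = \<i> * exp (-2 * (u m * of_real pi))" for m
  proof -
    have K1_eq: "K1 m = u m + \<i> * (of_nat m + 3 / 4)"
      by (simp add: u_def right_diff_distrib) (simp add: wnum_def algebra_simps)
    have "exp (- (2 * of_nat m * of_real pi) * \<i>) = 1"
      using exp_two_pi_i exp_of_nat_mult[of m "- (2 * of_real pi * \<i>)"]
      by (simp add: exp_minus algebra_simps)
    moreover have "exp (- (3 / 2 * of_real pi) * \<i>) = cis (- (3 / 2 * pi))"
      by (simp add: cis_conv_exp mult.commute)
    moreover have "cis (- (3 / 2 * pi)) = \<i>"
      by (simp only: complex_eq_iff cis.sel cos_minus sin_minus cos_3over2_pi sin_3over2_pi) simp
    moreover have "-2 * (K1 m * of_real pi) = - (2 * of_nat m * of_real pi) * \<i>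
        + (- (3 / 2 * of_real pi) * \<i> + -2 * (u m * of_real pi))"
      by (simp add: K1_eq algebra_simps)
    ultimately show ?thesis unfolding exp_wave_num_def by (simp only: exp_add) simp
  qed
  ultimately show ?thesis by simp
qed

lemma exp_wave_num2: "approx 1 (\<lambda>m. exp_wave_num (K2 m)) 0"
proof -
  have "(\<lambda>m. Re (K2 m / cwnum m)) \<longlonglongrightarrow> 1"
    using tendsto_Re[OF approx_tendsto[OF K2]] by simp
  then have "\<forall>\<^sub>F m in sequentially. Re (K2 m / cwnum m) > 1 / 2"
    by (rule order_tendstoD) simp
  then have "\<forall>\<^sub>F m in sequentially. norm (exp_wave_num (K2 m)) \<le> 1 * norm (1 / cwnum m)"
  proof eventually_elim
    case (elim m)
    have "wnum m / 2 \<le> Re (K2 m)" using elim by (simp add: Re_divide_of_real field_simps)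
    moreover have "pi > 1" using pi_gt3 by simp
    ultimately have "wnum m / 2 * 1 \<le> Re (K2 m) * pi"
      by (intro mult_mono) (auto intro: order_trans[of 0 "wnum m / 2"])
    then have "norm (exp_wave_num (K2 m)) \<le> exp (- wnum m)"
      by (simp add: exp_wave_num_def norm_exp_eq_Re)
    also have "wnum m \<le> exp (wnum m)" using exp_ge_add_one_self[of "wnum m"] by linarith
    then have "exp (- wnum m) \<le> 1 / wnum m" by (simp add: exp_minus field_simps)
    finally show ?case by (simp add: norm_divide)
  qed
  then show ?thesis unfolding approx_def by (intro bigoI[of _ 1]) simp
qed

lemma exp_wave_num3: "\<exists>q<1. \<forall>\<^sub>F m in sequentially. norm (exp_wave_num (K3 m)) < q"
proof -
  \<comment> \<open>The modulus tends to q^2, so q itself separates the limit from 1.\<close>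
  define q where "q = exp (- (thermal_slope / (2 * t2)) * pi)"
  have q: "q < 1" using thermal_slope(1) pos by (simp add: q_def)
  have "(\<lambda>m. exp (-2 * (Re (K3 m) * pi))) \<longlonglongrightarrow> exp (-2 * (thermal_slope / (2 * t2) * pi))"
    by (intro tendsto_intros Re_K3)
  moreover have "exp (-2 * (thermal_slope / (2 * t2) * pi)) < q"
    using thermal_slope(1) pos by (simp add: q_def field_simps)
  ultimately have "\<forall>\<^sub>F m in sequentially. exp (-2 * (Re (K3 m) * pi)) < q"
    by (rule order_tendstoD)
  then show ?thesis using q by (intro exI[of _ q]) (simp add: exp_wave_num_def norm_exp_eq_Re)
qed

section \<open>Cotangents, amplitudes and junction quantities\<close>

lemma coth_wave_num1: "approx 1 (\<lambda>m. coth_wave_num (K1 m) / cwnum m) (-1)"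
proof -
  have nz: "1 - \<i> \<noteq> 0" by (simp add: complex_eq_iff)
  have "approx 1 (\<lambda>m. K1 m / cwnum m * ((1 + exp_wave_num (K1 m)) / (1 - exp_wave_num (K1 m)))) (\<i>
      * ((1 + \<i>) / (1 - \<i>)))"
    using approx_mult[OF approx_weaken[OF K1] approx_divide[OF approx_add[OF approx_const exp_wave_num1]
      approx_diff[OF approx_const exp_wave_num1] nz]] by simp
  moreover have "\<i> * ((1 + \<i>) / (1 - \<i>)) = -1"
    using nz by (simp add: field_simps)
  ultimately show ?thesis by (simp only: coth_wave_num_def times_divide_eq_left)
qed

lemma coth_wave_num2: "approx 1 (\<lambda>m. coth_wave_num (K2 m) / cwnum m) 1"
proof -
  have "approx 1 (\<lambda>m. K2 m / cwnum m * ((1 + exp_wave_num (K2 m)) / (1 - exp_wave_num (K2 m)))) (1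
      * ((1 + 0) / (1 - 0)))"
    by (rule approx_mult[OF approx_weaken[OF K2] approx_divide[OF approx_add[OF approx_const
        exp_wave_num2]
      approx_diff[OF approx_const exp_wave_num2]]]) simp_all
  then show ?thesis by (simp only: coth_wave_num_def times_divide_eq_left) simp
qed

text \<open>No limit is claimed, since Im K3 grows like M^2 with uncontrolled phase. The bound q < 1
  on the exponential keeps the quotient bounded, which suffices because the third mode enters with
  additional negative powers of M.\<close>

lemma coth_wave_num3: "(\<lambda>m. coth_wave_num (K3 m) / cwnum m ^ 2) \<in> O(\<lambda>_. 1)"
proof -
  obtain q where q: "q < 1" "\<forall>\<^sub>F m in sequentially. norm (exp_wave_num (K3 m)) < q" using
      exp_wave_num3 by blast
  from q(2) have "\<forall>\<^sub>F m in sequentially. norm ((1 + exp_wave_num (K3 m)) / (1 - exp_wave_num (K3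
      m))) \<le> 2 / (1 - q) * norm (1::complex)"
  proof eventually_elim
    case (elim m)
    have "norm (1 + exp_wave_num (K3 m)) \<le> 2"
      using norm_triangle_ineq[of 1 "exp_wave_num (K3 m)"] elim q(1) by simp
    moreover have "1 - q \<le> norm (1 - exp_wave_num (K3 m))"
      using norm_triangle_ineq2[of 1 "exp_wave_num (K3 m)"] elim by simp
    ultimately show ?case using q(1) by (simp add: norm_divide frac_le)
  qed
  then have "(\<lambda>m. (1 + exp_wave_num (K3 m)) / (1 - exp_wave_num (K3 m))) \<in> O(\<lambda>_. 1)" by (rule bigoI)
  from landau_o.big.mult[OF approx_imp_bounded[OF K3] this] show ?thesis
    by (simp only: coth_wave_num_def times_divide_eq_left mult_1_left)
qed

text \<open>Only the order M^2 is used later, so the limit stays unnamed.\<close>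

lemma heat_ratio1: "\<exists>a. approx 2 (\<lambda>m. heat_ratio (lam m) (K1 m) / cwnum m ^ 2) a"
proof -
  have "approx 2 (\<lambda>m. (lam m / cwnum m ^ 2)\<^sup>2 / ((K1 m)\<^sup>2 / cwnum m ^ 2) + a2 * ((K1 m)\<^sup>2 / cwnum
      m ^ 2))
     ((\<i> * root_beta)\<^sup>2 / (-1) + of_real a2 * (-1))"
    by (rule approx_add[OF approx_divide[OF approx_power[OF lam_W] K1_sq] approx_cmult[OF K1_sq]])
        simp_all
  then show ?thesis
    by (intro exI, rule approx_eqI[rotated 2])
      (simp_all add: heat_ratio_def add_divide_distrib power_divide power2_eq_square)
qed

lemma heat_ratio2: "\<exists>a. approx 2 (\<lambda>m. heat_ratio (lam m) (K2 m) / cwnum m ^ 2) a"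
proof -
  have "approx 2 (\<lambda>m. (lam m / cwnum m ^ 2)\<^sup>2 / ((K2 m)\<^sup>2 / cwnum m ^ 2) + a2 * ((K2 m)\<^sup>2 / cwnum
      m ^ 2))
     ((\<i> * root_beta)\<^sup>2 / 1 + of_real a2 * 1)"
    by (rule approx_add[OF approx_divide[OF approx_power[OF lam_W] K2_sq] approx_cmult[OF K2_sq]])
        simp_all
  then show ?thesis
    by (intro exI, rule approx_eqI[rotated 2])
      (simp_all add: heat_ratio_def add_divide_distrib power_divide power2_eq_square)
qed

lemma heat_ratio3: "approx 2 (\<lambda>m. heat_ratio (lam m) (K3 m) / cwnum m ^ 4) (- (a2 * (root_beta\<^sup>2 *
    thermal_slope\<^sup>2)))"
proof -
  have nz: "- complex_of_real (root_beta\<^sup>2 * thermal_slope\<^sup>2) \<noteq> 0" using parameters_pos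
      thermal_slope pos by simp
  have K3': "approx 2 (\<lambda>m. (K3 m)\<^sup>2 / cwnum m ^ 4) (- complex_of_real (root_beta\<^sup>2 * thermal_slope\<^sup>2))"
    using K3_sq by simp
  have "approx 2 (\<lambda>m. (1 / cwnum m ^ 2) * ((1 / cwnum m ^ 2) * ((lam m / cwnum m ^ 2)\<^sup>2 / ((K3
      m)\<^sup>2 / cwnum m ^ 4)))
        + a2 * ((K3 m)\<^sup>2 / cwnum m ^ 4))
     (0 * (0 * ((\<i> * root_beta)\<^sup>2 / (- complex_of_real (root_beta\<^sup>2 * thermal_slope\<^sup>2)))) + a2 *
         (- complex_of_real (root_beta\<^sup>2 * thermal_slope\<^sup>2)))"
    by (rule approx_add[OF approx_mult[OF inverse_wnum_sq approx_mult[OF inverse_wnum_sq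
        approx_divide[OF approx_power[OF lam_W] K3' nz]]]
          approx_cmult[OF K3']]) simp
  then show ?thesis
    by (rule approx_eqI[rotated 2])
      (simp_all add: heat_ratio_def add_divide_distrib power_divide power2_eq_square power4_eq_xxxx)
qed

definition "amp1 m = plate_amp1 (lam m) (K1 m) (K2 m) (K3 m)"
definition "amp2 m = plate_amp2 (lam m) (K1 m) (K2 m) (K3 m)"
definition "amp3 m = plate_amp3 (lam m) (K1 m) (K2 m) (K3 m)"

lemma heat_ratio3_nz: "- (a2 * (root_beta\<^sup>2 * thermal_slope\<^sup>2)) \<noteq> 0"
  using pos parameters_pos thermal_slope(1) by simp

text \<open>The third cotangent and the heat ratio of a plate mode are O(M^2) each, and the third
  heat ratio has size M^4. The product is thus bounded, one power below the first two amplitudes,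
  which have size M.\<close>

lemma coupling:
  assumes "\<exists>a. approx 2 (\<lambda>m. heat_ratio (lam m) (k m) / cwnum m ^ 2) a"
  shows "approx 1 (\<lambda>m. coth_wave_num (K3 m) * heat_ratio (lam m) (k m) / heat_ratio (lam m) (K3 m)
      / cwnum m) 0"
proof -
  obtain a where a: "approx 2 (\<lambda>m. heat_ratio (lam m) (k m) / cwnum m ^ 2) a" using assms by blast
  have "approx 2 (\<lambda>m. heat_ratio (lam m) (k m) / cwnum m ^ 2 / (heat_ratio (lam m) (K3 m) / cwnum
      m ^ 4))
      (a / of_real (- (a2 * (root_beta\<^sup>2 * thermal_slope\<^sup>2))))"
    using heat_ratio3_nz by (intro approx_divide[OF a heat_ratio3]) (simp_all only:
        of_real_eq_0_iff, simp)
  from landau_o.big.mult[OF coth_wave_num3 approx_imp_bounded[OF this]]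
  have "(\<lambda>m. coth_wave_num (K3 m) / cwnum m ^ 2 * (heat_ratio (lam m) (k m) / cwnum m ^ 2 /
      (heat_ratio (lam m) (K3 m) / cwnum m ^ 4)))
      \<in> O(\<lambda>_. 1)" by simp
  from approx_0_bounded[OF inverse_wnum this] show ?thesis
    by (rule approx_eqI[rotated 2]) (simp_all add: power2_eq_square power4_eq_xxxx)
qed

lemma amp1: "approx 1 (\<lambda>m. amp1 m / cwnum m) 1"
  using approx_diff[OF coth_wave_num2 coupling[OF heat_ratio2]] by (simp add: amp1_def
      plate_amp1_def diff_divide_distrib)

lemma amp2: "approx 1 (\<lambda>m. amp2 m / cwnum m) 1"
  using approx_diff[OF coupling[OF heat_ratio1] coth_wave_num1] by (simp add: amp2_def
      plate_amp2_def diff_divide_distrib)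

lemma amp3: "approx 1 amp3 0"
proof -
  obtain a b where a: "approx 2 (\<lambda>m. heat_ratio (lam m) (K1 m) / cwnum m ^ 2) a"
    and b: "approx 2 (\<lambda>m. heat_ratio (lam m) (K2 m) / cwnum m ^ 2) b" using heat_ratio1
        heat_ratio2 by blast
  have "(\<lambda>m. (coth_wave_num (K1 m) / cwnum m * (heat_ratio (lam m) (K2 m) / cwnum m ^ 2)
      - coth_wave_num (K2 m) / cwnum m * (heat_ratio (lam m) (K1 m) / cwnum m ^ 2)) / (heat_ratio
          (lam m) (K3 m) / cwnum m ^ 4)) \<in> O(\<lambda>_. 1)"
    by (rule approx_imp_bounded[of 1], rule approx_divide[OF approx_diff[OF approx_mult[OF
        coth_wave_num1 approx_weaken[OF b]]
      approx_mult[OF coth_wave_num2 approx_weaken[OF a]]] approx_weaken[OF heat_ratio3]])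
      (use heat_ratio3_nz in \<open>simp_all only: of_real_eq_0_iff, simp_all\<close>)
  note bdd = this
  have eq: "1 / w * ((p / w * (q / w ^ 2) - r / w * (s / w ^ 2)) / (t / w ^ 4)) = (p * q - r * s) / t"
    if "w \<noteq> 0" for w p q r s t :: complex
    using that by (cases "t = 0") (simp_all add: field_simps power2_eq_square power4_eq_xxxx)
  show ?thesis
    by (rule approx_eqI[OF _ refl approx_0_bounded[OF inverse_wnum bdd]], subst eq) (simp_all add:
        amp3_def plate_amp3_def)
qed

lemma junction_value: "approx 1 (\<lambda>m. junction_value (lam m) (K1 m) (K2 m) (K3 m) / cwnum m) 2"
proof -
  have "approx 1 (\<lambda>m. amp1 m / cwnum m + amp2 m / cwnum m + 1 / cwnum m * amp3 m) (1 + 1 + 0 * 0)"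
    by (rule approx_add[OF approx_add[OF amp1 amp2] approx_mult[OF inverse_wnum amp3]])
  then show ?thesis
    by (rule approx_eqI[rotated 2]) (simp_all add: junction_value_def amp1_def amp2_def amp3_def
        add_divide_distrib)
qed

text \<open>Between the two plate modes the cotangents and the squared wave numbers both change
  sign, so the contributions 1 + 1 add up. The third is smaller because K3^2, of size M^4, stands in
  its denominator.\<close>

lemma junction_flux: "approx 1 (\<lambda>m. junction_flux (lam m) (K1 m) (K2 m) (K3 m)) 2"
proof -
  have K3_sq': "approx 1 (\<lambda>m. (K3 m)\<^sup>2 / cwnum m ^ 4) (- complex_of_real (root_beta\<^sup>2 *
      thermal_slope\<^sup>2))"
    using approx_weaken[OF K3_sq, of 1] by simp
  have nz: "- complex_of_real (root_beta\<^sup>2 * thermal_slope\<^sup>2) \<noteq> 0" using parameters_pos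
      thermal_slope(1) by simp
  from landau_o.big.mult[OF coth_wave_num3 approx_imp_bounded[OF approx_divide[OF amp3 K3_sq' nz]]]
  have "(\<lambda>m. coth_wave_num (K3 m) / cwnum m ^ 2 * (amp3 m / ((K3 m)\<^sup>2 / cwnum m ^ 4))) \<in> O(\<lambda>_. 1)"
      by simp
  from approx_0_bounded[OF inverse_wnum_sq this]
  have 3: "approx 1 (\<lambda>m. 1 / cwnum m ^ 2 * (coth_wave_num (K3 m) / cwnum m ^ 2 * (amp3 m / ((K3
      m)\<^sup>2 / cwnum m ^ 4)))) 0"
    by (rule approx_weaken) simp
  have "approx 1 (\<lambda>m. coth_wave_num (K1 m) / cwnum m * (amp1 m / cwnum m) / ((K1 m)\<^sup>2 / cwnum m ^ 2)
      + coth_wave_num (K2 m) / cwnum m * (amp2 m / cwnum m) / ((K2 m)\<^sup>2 / cwnum m ^ 2)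
      + 1 / cwnum m ^ 2 * (coth_wave_num (K3 m) / cwnum m ^ 2 * (amp3 m / ((K3 m)\<^sup>2 / cwnum m ^ 4))))
      ((-1) * 1 / (-1) + 1 * 1 / 1 + 0)"
    by (rule approx_add[OF approx_add[OF approx_divide[OF approx_mult[OF coth_wave_num1 amp1]
        approx_weaken[OF K1_sq]]
        approx_divide[OF approx_mult[OF coth_wave_num2 amp2] approx_weaken[OF K2_sq]]] 3]) simp_all
  then show ?thesis
    by (rule approx_eqI[rotated 2])
      (simp_all add: junction_flux_def amp1_def amp2_def amp3_def power2_eq_square power4_eq_xxxx)
qed

definition "C0 = b2 * wave_speed / (d2 * root_beta)"

lemma tanh_of_roots: "approx 1 (\<lambda>m. cwnum m * tanh_of_roots (lam m) (z1 m) (z2 m) (z3 m)) (\<i> * C0)"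
proof -
  have nz: "\<i> * root_beta * 2 \<noteq> 0" using parameters_pos by simp
  have "approx 1 (\<lambda>m. - of_real (b2 * wave_speed / d2) * (junction_value (lam m) (K1 m) (K2 m) (K3
      m) / cwnum m)
     / (lam m / cwnum m ^ 2 * junction_flux (lam m) (K1 m) (K2 m) (K3 m))) (- of_real (b2 *
         wave_speed / d2) * 2 / (\<i> * root_beta * 2))"
    by (rule approx_divide[OF approx_cmult[OF junction_value] approx_mult[OF approx_weaken[OF
        lam_W] junction_flux] nz]) simp_all
  then show ?thesis
  proof (rule approx_eqI[rotated 2])
    show "\<i> * C0 = - of_real (b2 * wave_speed / d2) * 2 / (\<i> * root_beta * 2)"
      using pos parameters_pos by (simp add: C0_def field_simps)
  qed (simp add: tanh_of_roots_def tanh_value_def K1_def K2_def K3_def power2_eq_square)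
qed

lemma tanh_of_roots_0: "approx 1 (\<lambda>m. tanh_of_roots (lam m) (z1 m) (z2 m) (z3 m)) 0"
  by (rule approx_eqI[OF _ _ approx_0_bounded[OF inverse_wnum approx_imp_bounded[OF
      tanh_of_roots]]]) simp_all

end

section \<open>Existence of slowly decaying eigenvalues\<close>

text \<open>The radius of the search disc is a compromise: it must tend to 0, yet eventually exceed
  corrections of order 1 / M.\<close>

lemma approx_le_inverse_sqrt:
  assumes "approx 1 f 0"
  shows "\<forall>\<^sub>F m in sequentially. norm (f m) \<le> 1 / sqrt (wnum m)"
proof -
  obtain C where C: "\<forall>\<^sub>F m in sequentially. norm (f m - 0) \<le> C * norm (1 / cwnum m ^ 1)"
    using assms unfolding approx_def by (elim landau_o.bigE)
  have "filterlim (\<lambda>m. sqrt (wnum m)) at_top sequentially"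
    by (rule filterlim_compose[OF sqrt_at_top filterlim_wnum])
  then have "\<forall>\<^sub>F m in sequentially. C \<le> sqrt (wnum m)"
    unfolding filterlim_at_top by blast
  with C show ?thesis
  proof eventually_elim
    case (elim m)
    have "norm (f m) \<le> C / wnum m" using elim(1) by (simp add: norm_divide)
    also have "\<dots> \<le> sqrt (wnum m) / wnum m" using elim(2) by (intro divide_right_mono) auto
    also have "\<dots> = 1 / sqrt (wnum m)" by (simp add: real_div_sqrt field_simps)
    finally show ?case .
  qed
qed

lemma Re_divide_cwnum_pos: "Re (w / cwnum m ^ 2) > 0 \<longleftrightarrow> Re w > 0"
  by (simp add: zero_less_divide_iff flip: of_real_power)

context plate_wave_seq
begin

abbreviation "G m \<equiv> tanh_of_roots (lam m) (z1 m) (z2 m) (z3 m)"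

lemma quotient: "approx 1 (\<lambda>m. (1 + G m) / (1 - G m)) 1"
proof -
  have "approx 1 (\<lambda>m. (1 + G m) / (1 - G m)) ((1 + 0) / (1 - 0))"
    by (rule approx_divide[OF approx_add[OF approx_const tanh_of_roots_0] approx_diff[OF
        approx_const tanh_of_roots_0]]) simp_all
  then show ?thesis by simp
qed

lemma eventually_nondegenerate: "\<forall>\<^sub>F m in sequentially. nondegenerate (lam m) (z1 m) (z2 m) (z3 m)"
proof -
  have "\<forall>\<^sub>F m in sequentially. 1 / cwnum m ^ 2 + t2 * (lam m / cwnum m ^ 2) \<noteq> 0"
    by (rule approx_eventually_neq[OF approx_add[OF inverse_wnum_sq approx_cmult[OF lam_W]]])
      (use pos parameters_pos in simp_all)
  then have 1: "\<forall>\<^sub>F m in sequentially. 1 + t2 * lam m \<noteq> 0"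
    by eventually_elim (metis add_divide_distrib div_0 times_divide_eq_right)
  have 2: "\<forall>\<^sub>F m in sequentially. Re (- (lam m * root_map1 (lam m) (z1 m))) > 0"
    using approx_eventually_Re_pos[OF arg1] by (simp only: Re_divide_cwnum_pos) simp
  have 3: "\<forall>\<^sub>F m in sequentially. Re (lam m * root_map2 (lam m) (z2 m)) > 0"
    using approx_eventually_Re_pos[OF arg2] by (simp only: Re_divide_cwnum_pos) simp
  have 4: "\<forall>\<^sub>F m in sequentially. Re (sq_ratio3 (lam m) (z3 m)) > 0"
    by (rule approx_eventually_Re_pos[OF sq_ratio3]) (use thermal_slope(1) in simp_all)
  have 5: "\<forall>\<^sub>F m in sequentially. root_map3 (lam m) (z3 m) \<noteq> 0"
    by (rule approx_eventually_neq[OF root_map3]) (use pos parameters_pos in simp_all)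
  have 6: "\<forall>\<^sub>F m in sequentially. exp_wave_num (K1 m) \<noteq> 1"
    by (rule approx_eventually_neq[OF exp_wave_num1]) (simp_all add: complex_eq_iff)
  have 7: "\<forall>\<^sub>F m in sequentially. exp_wave_num (K2 m) \<noteq> 1"
    by (rule approx_eventually_neq[OF exp_wave_num2]) simp_all
  obtain q where
      "q < 1" "\<forall>\<^sub>F m in sequentially. norm (exp_wave_num (K3 m)) < q" using exp_wave_num3 by blast
  then have 8: "\<forall>\<^sub>F m in sequentially. exp_wave_num (K3 m) \<noteq> 1"
    by (auto elim!: eventually_mono)
  have "\<forall>\<^sub>F m in sequentially. heat_ratio (lam m) (K3 m) / cwnum m ^ 4 \<noteq> 0"
    by (rule approx_eventually_neq[OF heat_ratio3]) (use heat_ratio3_nz in \<open>simp_all only: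
        of_real_eq_0_iff, simp_all\<close>)
  then have 9: "\<forall>\<^sub>F m in sequentially. heat_ratio (lam m) (K3 m) \<noteq> 0"
    by eventually_elim auto
  have 10: "\<forall>\<^sub>F m in sequentially. junction_flux (lam m) (K1 m) (K2 m) (K3 m) \<noteq> 0"
    by (rule approx_eventually_neq[OF junction_flux]) simp_all
  have "\<forall>\<^sub>F m in sequentially. junction_value (lam m) (K1 m) (K2 m) (K3 m) / cwnum m \<noteq> 0"
    by (rule approx_eventually_neq[OF junction_value]) simp_all
  then have 11: "\<forall>\<^sub>F m in sequentially. junction_value (lam m) (K1 m) (K2 m) (K3 m) \<noteq> 0"
    by eventually_elim auto
  have 12: "\<forall>\<^sub>F m in sequentially. G m \<noteq> 1" by (rule approx_eventually_neq[OF tanh_of_roots_0]) simp_all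
  have 13: "\<forall>\<^sub>F m in sequentially. G m \<noteq> -1" by (rule approx_eventually_neq[OF tanh_of_roots_0])
      simp_all
  have 14: "\<forall>\<^sub>F m in sequentially. Re ((1 + G m) / (1 - G m)) > 0"
    by (rule approx_eventually_Re_pos[OF quotient]) simp_all
  have 15: "\<forall>\<^sub>F m in sequentially. Re (radicand (lam m) (z1 m)) > 0"
    by (rule approx_eventually_Re_pos[OF radicand(1)]) simp_all
  have 16: "\<forall>\<^sub>F m in sequentially. Re (radicand (lam m) (z2 m)) > 0"
    by (rule approx_eventually_Re_pos[OF radicand(2)]) simp_all
  from lam_nonzero 1 2 3 4 5 6 7 8 9 10 11 12 13 14 15 16 show ?thesis
    by eventually_elim (simp only: nondegenerate_def K1_def K2_def K3_def simp_thms)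
qed

end

section \<open>Fixed points by Brouwer's theorem\<close>

context plate_wave
begin

text \<open>\<open>tanh_of_roots\<close> depends on \<open>z1\<close>, \<open>z2\<close>, \<open>z3\<close> only through their images under the root maps. The
  asymptotics of these images hold for arbitrary bounded arguments, so crude balls suffice for Brouwer's
  theorem.\<close>

definition eigenvalue_map :: "nat \<Rightarrow> complex \<times> complex \<times> complex \<times> complex \<Rightarrow> complex \<times> complex \<times>
  complex \<times> complex" where
  "eigenvalue_map m x = (case x of (l, z1, z2, z3) \<Rightarrow>
     (\<i> * of_real (centre m) + of_real (wave_speed / (2 * pi)) * Ln ((1 + tanh_of_roots l z1 z2
         z3) / (1 - tanh_of_roots l z1 z2 z3)),
      root_map1 l z1, root_map2 l z2, root_map3 l z3))"

text \<open>Strictly larger than the moduli 1 / \<open>root_beta\<close> (twice) and a2 /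
  \<open>beta\<close> of the three limits, so that images under the root maps eventually fall into
  the balls.\<close>

definition "root_bound = 1 / root_beta + a2 / beta + 1"

definition search_box :: "nat \<Rightarrow> (complex \<times> complex \<times> complex \<times> complex) set" where
  "search_box m = cball (\<i> * of_real (centre m)) (1 / sqrt (wnum m)) \<times> cball 0 root_bound \<times> cball
      0 root_bound \<times> cball 0 root_bound"

lemma root_bound_pos: "root_bound > 0" using parameters_pos pos by (simp add: root_bound_def
    add_pos_pos)

lemma plate_wave_seq_search_box:
  assumes "\<And>m. x m \<in> search_box m"
  shows "plate_wave_seq a1 a2 b2 g2 d2 t2 k2 (\<lambda>m. fst (x m)) (\<lambda>m. fst (snd (x m)))
    (\<lambda>m. fst (snd (snd (x m)))) (\<lambda>m. snd (snd (snd (x m)))) root_bound"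
proof
  fix m
  show "norm (fst (x m) - \<i> * centre m) \<le> 1 / sqrt (wnum m)"
    "norm (fst (snd (x m))) \<le> root_bound" "norm (fst (snd (snd (x m)))) \<le> root_bound" "norm (snd
        (snd (snd (x m)))) \<le> root_bound"
    using assms[of m] by (auto simp: search_box_def dist_norm norm_minus_commute)
qed

text \<open>Since G = O(1 / M), the quotient (1 + G) / (1 - G) is 1 + O(1 / M); its logarithm
  therefore moves l by less than the radius of the disc.\<close>

lemma eventually_self_map:
  "\<forall>\<^sub>F m in sequentially. \<forall>x\<in>search_box m. nondegenerate (fst x) (fst (snd x)) (fst (snd (snd x)))
      (snd (snd (snd x))) \<and>
     eigenvalue_map m x \<in> search_box m"
proof (rule eventually_Ball_if_sequences)
  show "search_box m \<noteq> {}" for m using root_bound_pos less_imp_le[OF wnum_pos(1)] by (simp add: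
      search_box_def not_less)
  fix x assume x: "\<And>m. x m \<in> search_box m"
  interpret S: plate_wave_seq a1 a2 b2 g2 d2 t2 k2 "\<lambda>m. fst (x m)" "\<lambda>m. fst (snd (x m))"
    "\<lambda>m. fst (snd (snd (x m)))" "\<lambda>m. snd (snd (snd (x m)))" root_bound
    by (rule plate_wave_seq_search_box[OF x])
  have "approx 1 (\<lambda>m. of_real (wave_speed / (2 * pi)) * Ln ((1 + S.G m) / (1 - S.G m))) (of_real
      (wave_speed / (2 * pi)) * Ln 1)"
    by (rule approx_cmult[OF approx_Ln[OF S.quotient]]) simp_all
  then have 1: "\<forall>\<^sub>F m in sequentially. norm (of_real (wave_speed / (2 * pi)) * Ln ((1 + S.G m) /
      (1 - S.G m)))
      \<le> 1 / sqrt (wnum m)"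
    by (intro approx_le_inverse_sqrt) simp
  have less: "\<forall>\<^sub>F m in sequentially. norm (f m) < root_bound" if "approx j f a" "j > 0" "norm a <
      root_bound" for j f a
    using order_tendstoD(2)[OF tendsto_norm[OF approx_tendsto[OF that(1,2)]] that(3)] .
  have "1 / root_beta < root_bound" "a2 / beta < root_bound" using parameters_pos pos by (simp_all
      add: root_bound_def add_pos_pos)
  then have r: "norm (\<i> / root_beta) < root_bound" "norm (- (\<i> / root_beta)) < root_bound" "norm
      (complex_of_real (a2 / beta)) < root_bound"
    using parameters_pos pos by (simp_all add: norm_divide)
  show "\<forall>\<^sub>F m in sequentially. nondegenerate (fst (x m)) (fst (snd (x m))) (fst (snd (snd (x m))))
      (snd (snd (snd (x m)))) \<and>
     eigenvalue_map m (x m) \<in> search_box m"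
    using S.eventually_nondegenerate 1 less[OF S.root_map1 zero_less_numeral r(1)] less[OF
        S.root_map2 zero_less_numeral r(2)]
      less[OF S.root_map3 zero_less_numeral r(3)]
    by eventually_elim (auto simp: eigenvalue_map_def search_box_def dist_norm norm_minus_commute
        split: prod.splits)
qed

lemma isCont_tanh_value:
  assumes "isCont L x" "isCont p x" "isCont q x" "isCont k x"
    "L x \<noteq> 0" "p x \<noteq> 0" "q x \<noteq> 0" "k x \<noteq> 0" "exp_wave_num (p x) \<noteq> 1" "exp_wave_num (q x) \<noteq> 1"
        "exp_wave_num (k x) \<noteq> 1"
    "heat_ratio (L x) (k x) \<noteq> 0" "junction_flux (L x) (p x) (q x) (k x) \<noteq> 0"
  shows "isCont (\<lambda>x. tanh_value (L x) (p x) (q x) (k x)) x"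
proof -
  have coth_wave_num: "isCont (\<lambda>x. coth_wave_num (f x)) x" if "isCont f x" "exp_wave_num (f x) \<noteq>
      1" for f :: "'a \<Rightarrow> complex"
    unfolding coth_wave_num_def using that(2) unfolding exp_wave_num_def by (intro
        continuous_intros that) auto
  have heat_ratio: "isCont (\<lambda>x. heat_ratio (L x) (f x)) x" if "isCont f x" "f x \<noteq> 0" for f :: "'a
      \<Rightarrow> complex"
    unfolding heat_ratio_def by (intro continuous_intros that assms) (use that in auto)
  have X: "isCont (\<lambda>x. plate_amp1 (L x) (p x) (q x) (k x)) x" "isCont (\<lambda>x. plate_amp2 (L x) (p x)
      (q x) (k x)) x"
      "isCont (\<lambda>x. plate_amp3 (L x) (p x) (q x) (k x)) x"
    unfolding plate_amp1_def plate_amp2_def plate_amp3_def by (intro continuous_intros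
        coth_wave_num heat_ratio assms)+
  have "isCont (\<lambda>x. junction_value (L x) (p x) (q x) (k x)) x"
    unfolding junction_value_def by (intro continuous_intros X)
  moreover have "isCont (\<lambda>x. junction_flux (L x) (p x) (q x) (k x)) x"
    unfolding junction_flux_def by (intro continuous_intros X coth_wave_num assms) (use assms in auto)
  ultimately show ?thesis
    unfolding tanh_value_def by (intro continuous_intros assms) (use assms in auto)
qed

lemma nondegenerate_wave_nums:
  assumes "nondegenerate l z1 z2 z3"
  shows "wave_num1 l z1 \<noteq> 0" "wave_num2 l z2 \<noteq> 0" "wave_num3 l z3 \<noteq> 0"
  using assms by (auto simp: nondegenerate_def wave_num1_def wave_num2_def wave_num3_def)

lemma isCont_eigenvalue_map:
  assumes "nondegenerate (fst x) (fst (snd x)) (fst (snd (snd x))) (snd (snd (snd x)))"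
  shows "isCont (eigenvalue_map m) x"
proof -
  define L where "L x = fst x" for x :: "complex \<times> complex \<times> complex \<times> complex"
  define y1 where "y1 x = fst (snd x)" for x :: "complex \<times> complex \<times> complex \<times> complex"
  define y2 where "y2 x = fst (snd (snd x))" for x :: "complex \<times> complex \<times> complex \<times> complex"
  define y3 where "y3 x = snd (snd (snd x))" for x :: "complex \<times> complex \<times> complex \<times> complex"
  have c: "isCont L x" "isCont y1 x" "isCont y2 x" "isCont y3 x"
    unfolding L_def y1_def y2_def y3_def by (intro continuous_intros)+
  have g: "nondegenerate (L x) (y1 x) (y2 x) (y3 x)"
    using assms by (simp add: L_def y1_def y2_def y3_def)
  note nz = g[unfolded nondegenerate_def] nondegenerate_wave_nums[OF g]
  have np: "radicand (L x) (y1 x) \<notin> \<real>\<^sub>\<le>\<^sub>0" "radicand (L x) (y2 x) \<notin> \<real>\<^sub>\<le>\<^sub>0" "- (L x * root_map1 (L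
      x) (y1 x)) \<notin> \<real>\<^sub>\<le>\<^sub>0"
    "L x * root_map2 (L x) (y2 x) \<notin> \<real>\<^sub>\<le>\<^sub>0" "sq_ratio3 (L x) (y3 x) \<notin> \<real>\<^sub>\<le>\<^sub>0"
    "(1 + tanh_of_roots (L x) (y1 x) (y2 x) (y3 x)) / (1 - tanh_of_roots (L x) (y1 x) (y2 x) (y3
        x)) \<notin> \<real>\<^sub>\<le>\<^sub>0"
    by (rule Re_pos_not_nonpos, use nz in blast)+
  have sigma: "isCont (\<lambda>x. sigma (L x)) x"
    unfolding sigma_def by (intro continuous_intros c) (use nz in auto)
  have radicand: "isCont (\<lambda>x. radicand (L x) (y1 x)) x" "isCont (\<lambda>x. radicand (L x) (y2 x)) x"
    unfolding radicand_def by (intro continuous_intros c sigma)+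
  have root_map1: "isCont (\<lambda>x. root_map1 (L x) (y1 x)) x"
    unfolding root_map1_def by (intro continuous_mult continuous_const isCont_csqrt' radicand np)
  have root_map2: "isCont (\<lambda>x. root_map2 (L x) (y2 x)) x"
    unfolding root_map2_def by (intro continuous_mult continuous_const isCont_csqrt' radicand np)
  have root_map3: "isCont (\<lambda>x. root_map3 (L x) (y3 x)) x"
    unfolding root_map3_def using parameters_pos by (intro continuous_intros c sigma) auto
  have sq_ratio3: "isCont (\<lambda>x. sq_ratio3 (L x) (y3 x)) x"
    unfolding sq_ratio3_def using nz pos by (intro continuous_intros c root_map3) auto
  have wave_num1: "isCont (\<lambda>x. wave_num1 (L x) (y1 x)) x"
    unfolding wave_num1_def
    by (intro continuous_mult continuous_minus continuous_const isCont_csqrt' c root_map1 np)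
  have wave_num2: "isCont (\<lambda>x. wave_num2 (L x) (y2 x)) x"
    unfolding wave_num2_def
    by (intro continuous_mult continuous_const isCont_csqrt' c root_map2 np)
  have wave_num3: "isCont (\<lambda>x. wave_num3 (L x) (y3 x)) x"
    unfolding wave_num3_def
    by (intro continuous_mult continuous_const isCont_csqrt' c sq_ratio3 np)
  have G: "isCont (\<lambda>x. tanh_of_roots (L x) (y1 x) (y2 x) (y3 x)) x"
    unfolding tanh_of_roots_def using nz by (intro isCont_tanh_value c wave_num1 wave_num2
        wave_num3) auto
  have "isCont (\<lambda>x. (1 + tanh_of_roots (L x) (y1 x) (y2 x) (y3 x)) / (1 - tanh_of_roots (L x) (y1
      x) (y2 x) (y3 x))) x"
    by (intro continuous_intros G) (use nz in auto)
  then have "isCont (\<lambda>x. Ln ((1 + tanh_of_roots (L x) (y1 x) (y2 x) (y3 x)) / (1 - tanh_of_roots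
      (L x) (y1 x) (y2 x) (y3 x)))) x"
    by (intro isCont_Ln' np)
  then have "isCont (\<lambda>x. (\<i> * of_real (centre m) +
      of_real (wave_speed / (2 * pi)) * Ln ((1 + tanh_of_roots (L x) (y1 x) (y2 x) (y3 x)) / (1 -
          tanh_of_roots (L x) (y1 x) (y2 x) (y3 x))),
      root_map1 (L x) (y1 x), root_map2 (L x) (y2 x), root_map3 (L x) (y3 x))) x"
    by (intro continuous_Pair continuous_add continuous_mult continuous_const root_map1 root_map2
        root_map3)
  then show ?thesis
    by (rule isCont_cong[THEN iffD1, rotated])
      (simp add: eigenvalue_map_def L_def y1_def y2_def y3_def case_prod_unfold)
qed

lemma eventually_fixpoint:
  "\<forall>\<^sub>F m in sequentially. \<exists>x\<in>search_box m. eigenvalue_map m x = x \<and> nondegenerate (fst x) (fst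
      (snd x)) (fst (snd (snd x))) (snd (snd (snd x)))"
  using eventually_self_map
proof eventually_elim
  case (elim m)
  have "compact (search_box m)" "convex (search_box m)" "search_box m \<noteq> {}"
    using root_bound_pos less_imp_le[OF wnum_pos(1)] unfolding search_box_def
    by (auto intro!: compact_Times convex_Times simp: not_less)
  moreover have "continuous_on (search_box m) (eigenvalue_map m)"
    using elim by (intro continuous_at_imp_continuous_on ballI isCont_eigenvalue_map) blast
  moreover have "eigenvalue_map m \<in> search_box m \<rightarrow> search_box m" using elim by blast
  ultimately obtain x where "x \<in> search_box m" "eigenvalue_map m x = x" by (rule brouwer)
  then show ?case using elim by blast
qed

section \<open>From fixed points to eigenvectors\<close>

lemma exp_wave_num_neq_1_imp: "exp_wave_num k \<noteq> 1 \<Longrightarrow> sinh (k * of_real pi) \<noteq> 0"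
proof
  assume "exp_wave_num k \<noteq> 1" "sinh (k * of_real pi) = 0"
  from this(2) have "exp (k * of_real pi) = exp (- (k * of_real pi))" by (simp add: sinh_field_def)
  then have "exp (k * of_real pi) * exp (- (k * of_real pi)) = exp (- (k * of_real pi)) * exp (-
      (k * of_real pi))"
    by simp
  then have "exp_wave_num k = 1" by (simp add: exp_wave_num_def flip: exp_add)
  then show False using \<open>exp_wave_num k \<noteq> 1\<close> by simp
qed

lemma coth_wave_num_eq: "k * cosh (k * of_real pi) / sinh (k * of_real pi) = coth_wave_num k"
  by (simp only: times_divide_eq_right[symmetric] coth_exp coth_wave_num_def exp_wave_num_def)

text \<open>Once the heat amplitude is eliminated by the plate equation, the defect in the heat
  equation of one mode is a multiple of the cubic in z; the factor b2 z clears the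
  denominators.\<close>

lemma heat_condition:
  fixes l z k A :: complex
  assumes "l \<noteq> 0" "z \<noteq> 0" "k\<^sup>2 = l * z" "1 - sigma l * z - sigma l * a2 * z ^ 3 + beta * z\<^sup>2 = 0"
  shows "- d2 * l * k\<^sup>2 * A + sigma l * k\<^sup>2 * (heat_ratio l k * A / b2) = l * (heat_ratio l k * A / b2)"
proof -
  have b2: "complex_of_real b2 \<noteq> 0" using pos by simp
  have heat_ratio: "heat_ratio l k = l * (1 / z + a2 * z)" using assms(1-3) by (simp add:
      heat_ratio_def field_simps power2_eq_square)
  have "b2 * z * (- d2 * l * k\<^sup>2 * A + sigma l * k\<^sup>2 * (heat_ratio l k * A / b2) - l * (heat_ratio
      l k * A / b2))
     = - (l\<^sup>2 * A * (1 - sigma l * z - sigma l * a2 * z ^ 3 + beta * z\<^sup>2))"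
    unfolding heat_ratio assms(3) using assms(2) b2
    by (simp add: beta_def field_simps power2_eq_square power3_eq_cube)
  also have "\<dots> = 0" using assms(4) by simp
  finally show ?thesis using b2 assms(2) by simp
qed

lemma plate_amp_orthogonal:
  assumes "heat_ratio l k \<noteq> 0"
  shows "plate_amp1 l p q k * heat_ratio l p + plate_amp2 l p q k * heat_ratio l q + plate_amp3 l
      p q k * heat_ratio l k = 0"
    and "coth_wave_num p * plate_amp1 l p q k + coth_wave_num q * plate_amp2 l p q k +
        coth_wave_num k * plate_amp3 l p q k = 0"
  using assms by (simp_all add: plate_amp1_def plate_amp2_def plate_amp3_def field_simps)

lemma cubic_roots:
  fixes l z z1 z2 z3 :: complex
  assumes "nondegenerate l z1 z2 z3" "z1 = root_map1 l z1" "z2 = root_map2 l z2" "z3 = root_map3 l z3"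
  shows "1 - sigma l * z1 - sigma l * a2 * z1 ^ 3 + beta * z1\<^sup>2 = 0"
    and "1 - sigma l * z2 - sigma l * a2 * z2 ^ 3 + beta * z2\<^sup>2 = 0"
    and "z = 1 / (sigma l * z3) \<Longrightarrow> 1 - sigma l * z - sigma l * a2 * z ^ 3 + beta * z\<^sup>2 = 0"
proof -
  have beta: "complex_of_real beta \<noteq> 0" "(complex_of_real root_beta)\<^sup>2 = beta" 
    using parameters_pos by (simp_all flip: of_real_power)
  have "z1\<^sup>2 = - radicand l z1 / beta"
    by (subst assms(2)) (simp add: root_map1_def power_mult_distrib power_divide beta)
  then show "1 - sigma l * z1 - sigma l * a2 * z1 ^ 3 + beta * z1\<^sup>2 = 0" using beta by (simp add:
      radicand_def)
  have "z2\<^sup>2 = - radicand l z2 / beta"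
    by (subst assms(3)) (simp add: root_map2_def power_mult_distrib power_divide beta)
  then show "1 - sigma l * z2 - sigma l * a2 * z2 ^ 3 + beta * z2\<^sup>2 = 0" using beta by (simp add:
      radicand_def)
  assume z: "z = 1 / (sigma l * z3)"
  have nz: "sigma l \<noteq> 0" "z3 \<noteq> 0" using assms(1,4) pos by (auto simp: nondegenerate_def sigma_def)
  have e: "beta * z3 = a2 + (sigma l)\<^sup>2 * (z3\<^sup>2 - z3 ^ 3)"
    by (subst assms(4)) (use beta in \<open>simp add: root_map3_def\<close>)
  \<comment> \<open>Clearing denominators turns the cubic at 1 / (sigma z3) into the fixed-point
    equation of \<open>root_map3\<close>.\<close>
  have "(sigma l)\<^sup>2 * z3 ^ 3 * (1 - sigma l * z - sigma l * a2 * z ^ 3 + beta * z\<^sup>2)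
      = beta * z3 - (a2 + (sigma l)\<^sup>2 * (z3\<^sup>2 - z3 ^ 3))"
    unfolding z using nz by (simp add: field_simps power2_eq_square power3_eq_cube)
  then show "1 - sigma l * z - sigma l * a2 * z ^ 3 + beta * z\<^sup>2 = 0" using e nz by simp
qed

lemma eigen_family_fixpoint:
  fixes l z1 z2 z3 :: complex
  assumes g: "nondegenerate l z1 z2 z3" and fp: "eigenvalue_map m (l, z1, z2, z3) = (l, z1, z2, z3)"
  shows "\<exists>U \<nu>. eigen_family l U \<nu>"
proof -
  define K where
      "K = (\<lambda>j::nat. if j = 0 then wave_num1 l z1 else if j = 1 then wave_num2 l z2 else wave_num3
      l z3)"
  define X where
      "X = (\<lambda>j::nat. if j = 0 then plate_amp1 l (K 0) (K 1) (K 2) else if j = 1 then plate_amp2 l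
      (K 0) (K 1) (K 2)
    else plate_amp3 l (K 0) (K 1) (K 2))"
  \<comment> \<open>Division by sinh makes \<open>X j\<close> the value of mode j at the junction;
    the plate equation then fixes B through b2 B = (l^2 / k^2 + a2 k^2) A.\<close>
  define A where "A j = X j / sinh (K j * pi)" for j
  define B where "B j = heat_ratio l (K j) * A j / b2" for j
  define G where "G = tanh_of_roots l z1 z2 z3"
  define N where "N = junction_value l (K 0) (K 1) (K 2)"
  define D where "D = junction_flux l (K 0) (K 1) (K 2)"
  define \<kappa> where "\<kappa> = l / wave_speed"
  define J where "J = {0, 1, 2::nat}"
  have z: "z1 = root_map1 l z1" "z2 = root_map2 l z2" "z3 = root_map3 l z3"
    and l_eq: "l = \<i> * centre m + of_real (wave_speed / (2 * pi)) * Ln ((1 + G) / (1 - G))"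
    using fp by (simp_all add: eigenvalue_map_def G_def)
  note nz = g[unfolded nondegenerate_def]
  have l: "l \<noteq> 0" "1 + t2 * l \<noteq> 0" using nz by simp_all
  have sigma: "sigma l \<noteq> 0" using l pos by (simp add: sigma_def)
  have ND: "N \<noteq> 0" "D \<noteq> 0" "heat_ratio l (K 2) \<noteq> 0" using nz by (simp_all add: N_def D_def K_def)
  have G1: "G \<noteq> 1" "G \<noteq> -1" using nz by (simp_all add: G_def)
  have Kj: "K j \<noteq> 0" "sinh (K j * pi) \<noteq> 0" for j
    using nondegenerate_wave_nums[OF g] nz exp_wave_num_neq_1_imp by (auto simp: K_def)
  have AX: "A j * sinh (K j * pi) = X j" for j using Kj by (simp add: A_def)
  have AT: "K j * A j * cosh (K j * pi) = coth_wave_num (K j) * X j" for j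
    unfolding coth_wave_num_eq[symmetric] by (simp add: A_def)
  have heat: "- d2 * l * (K j)\<^sup>2 * A j + sigma l * (K j)\<^sup>2 * B j = l * B j" for j
  proof -
    have "\<exists>y::complex. y \<noteq> 0 \<and> (K j)\<^sup>2 = l * y \<and> 1 - sigma l * y - sigma l * a2 * y ^ 3 + beta *
        y\<^sup>2 = 0"
    proof (cases "j = 0 \<or> j = 1")
      case True
      have "(wave_num1 l z1)\<^sup>2 = l * z1" by (subst (2) z(1)) (simp add: wave_num1_def
          power_mult_distrib)
      moreover have "(wave_num2 l z2)\<^sup>2 = l * z2" by (subst (2) z(2)) (simp add: wave_num2_def)
      moreover have "z1 \<noteq> 0" "z2 \<noteq> 0" using calculation nondegenerate_wave_nums[OF g] by auto
      ultimately show ?thesis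
        using True cubic_roots(1,2)[OF g z] by (auto simp: K_def)
    next
      case False
      have z3: "z3 \<noteq> 0" using nz z(3) by simp
      have "(wave_num3 l z3)\<^sup>2 = l\<^sup>2 * ((1 + t2 * l) / (l * of_real (g2 * k2) * z3))"
        by (simp add: wave_num3_def power_mult_distrib sq_ratio3_def flip: z(3))
      also have "\<dots> = l * (1 / (sigma l * z3))"
        using l z3 pos by (simp add: sigma_def field_simps power2_eq_square)
      finally show ?thesis
        using False cubic_roots(3)[OF g z refl] sigma z3 by (intro exI[of _ "1 / (sigma l * z3)"])
            (auto simp: K_def)
    qed
    then show ?thesis unfolding B_def using heat_condition[OF l(1)] by blast
  qed
  have flux: "a2 * (K j)\<^sup>2 * A j - b2 * B j = - (l\<^sup>2 / (K j)\<^sup>2 * A j)" for j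
  proof -
    have "b2 * B j = heat_ratio l (K j) * A j" using pos by (simp add: B_def)
    then show ?thesis by (simp add: heat_ratio_def algebra_simps)
  qed
  define w where "w = \<kappa> * pi"
  \<comment> \<open>The integer in \<open>centre\<close> contributes a multiple of 2 pi \<i> and
    disappears under the exponential. The result is tanh w = G, stated below without division as
    \<open>sinh w = G * cosh w\<close>.\<close>
  have Eq: "exp (2 * w) = (1 + G) / (1 - G)"
  proof -
    have "2 * w = 2 * of_int \<lfloor>root_beta * (wnum m)\<^sup>2 / wave_speed\<rfloor> * pi * \<i> + Ln ((1 + G) / (1 - G))"
      unfolding w_def \<kappa>_def l_eq using parameters_pos by (simp add: centre_def field_simps)
    moreover have "exp (complex_of_real (2 * real_of_int n * pi) * \<i>) = 1" for n
      by (rule exp_integer_2pi) simp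
    moreover have "exp (Ln ((1 + G) / (1 - G))) = (1 + G) / (1 - G)"
      using G1 by (intro exp_Ln) (auto simp: add_eq_0_iff)
    ultimately show ?thesis by (simp only: exp_add mult_1_left)
  qed
  have G_eq: "G = - (b2 * wave_speed / d2) * N / (l * D)"
    by (simp add: G_def tanh_of_roots_def tanh_value_def N_def D_def K_def)
  then have G0: "G \<noteq> 0" using ND l pos parameters_pos by simp
  have "exp (2 * w) * (1 - G) = 1 + G" using G1 unfolding Eq by simp
  moreover have "exp (2 * w) = exp w * exp w" by (simp flip: exp_add)
  ultimately have "exp w * (exp w - exp (- w)) = G * (exp w * (exp w + exp (- w)))"
    by (simp add: algebra_simps exp_minus)
  then have coth: "sinh w = G * cosh w"
    by (simp add: sinh_field_def cosh_field_def)
  have sinh: "sinh w \<noteq> 0"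
  proof
    assume "sinh w = 0"
    with coth G0 have "cosh w = 0" by simp
    with \<open>sinh w = 0\<close> show False using sinh_plus_cosh[of w] by simp
  qed
  show ?thesis
  proof (rule eigen_family_exists[where J = J and k = K and A = A and B = B and \<kappa> = \<kappa> and Y = "N /
      sinh w"])
    show "l \<noteq> 0" "1 + t2 * l \<noteq> 0" by (fact l)+
    show "a1 * \<kappa>\<^sup>2 = l\<^sup>2" using parameters_pos pos by (simp add: \<kappa>_def power_divide flip: of_real_power)
    show "N / sinh w * sinh (\<kappa> * pi) \<noteq> 0" using sinh ND by (simp add: w_def)
    show "- (K j)\<^sup>2 * (a2 * (K j)\<^sup>2 * A j - b2 * B j) = l\<^sup>2 * A j" for j
      unfolding flux using Kj by simp
    show "- d2 * l * (K j)\<^sup>2 * A j + g2 * k2 / (1 + t2 * l) * (K j)\<^sup>2 * B j = l * B j" for j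
      using heat[of j] by (simp add: sigma_def)
    show "N / sinh w * sinh (\<kappa> * pi) = (\<Sum>j\<in>J. A j * sinh (K j * pi))"
      using sinh unfolding AX by (simp add: w_def J_def X_def N_def junction_value_def)
    show "(\<Sum>j\<in>J. K j * A j * cosh (K j * pi)) = 0"
      unfolding AT using plate_amp_orthogonal(2)[OF ND(3), of "K 0" "K 1"] by (simp add: J_def
          X_def add.assoc)
    have "B j * sinh (K j * pi) = X j * heat_ratio l (K j) / b2" for j
      unfolding B_def AX[symmetric] by simp
    then have "(\<Sum>j\<in>J. B j * sinh (K j * pi)) = (\<Sum>j\<in>J. X j * heat_ratio l (K j)) / b2"
      by (simp add: sum_divide_distrib)
    also have "(\<Sum>j\<in>J. X j * heat_ratio l (K j)) = 0"
      using plate_amp_orthogonal(1)[OF ND(3), of "K 0" "K 1"] by (simp add: J_def X_def add.assoc)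
    finally show "(\<Sum>j\<in>J. B j * sinh (K j * pi)) = 0" by simp
    have "K j * (a2 * (K j)\<^sup>2 * A j - b2 * B j) * cosh (K j * pi) = - l\<^sup>2 * (coth_wave_num (K j) *
        X j / (K j)\<^sup>2)" for j
      unfolding flux AT[symmetric] by simp
    then have "(\<Sum>j\<in>J. K j * (a2 * (K j)\<^sup>2 * A j - b2 * B j) * cosh (K j * pi))
       = - l\<^sup>2 * (\<Sum>j\<in>J. coth_wave_num (K j) * X j / (K j)\<^sup>2)"
      unfolding sum_distrib_left by (rule sum.cong[OF refl])
    also have "(\<Sum>j\<in>J. coth_wave_num (K j) * X j / (K j)\<^sup>2) = D"
      by (simp add: J_def D_def junction_flux_def X_def add.assoc)
    finally have "d2 / b2 * (\<Sum>j\<in>J. K j * (a2 * (K j)\<^sup>2 * A j - b2 * B j) * cosh (K j * pi))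
       = d2 / b2 * (- l\<^sup>2 * D)" by (rule arg_cong)
    also have "\<dots> = a1 * \<kappa> * N / G"
    proof -
      have "complex_of_real a1 = (complex_of_real wave_speed)\<^sup>2"
        using parameters_pos(5) by (metis of_real_power)
      then have a: "a1 * \<kappa> = wave_speed * l" using parameters_pos(3) by (simp add: \<kappa>_def
          power2_eq_square)
      have "N = - (d2 / (b2 * wave_speed)) * (G * (l * D))"
        unfolding G_eq using ND l pos parameters_pos(3) by simp
      then show ?thesis unfolding a using G0 pos parameters_pos(3) by (simp add: power2_eq_square)
    qed
    also have "\<dots> = a1 * \<kappa> * (N / sinh w) * cosh (\<kappa> * pi)"
      using coth G0 sinh by (simp add: w_def field_simps)
    finally show "d2 / b2 * (\<Sum>j\<in>J. K j * (a2 * (K j)\<^sup>2 * A j - b2 * B j) * cosh (K j * pi))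
       = a1 * \<kappa> * (N / sinh w) * cosh (\<kappa> * pi)" .
  qed
qed

end

section \<open>The real part of the eigenvalues\<close>

context plate_wave_seq
begin

text \<open>Up to an error of order \<open>wnum m ^ -2\<close> the value \<open>G m\<close> is purely imaginary, so that
  \<open>(1 + G m) / (1 - G m)\<close> has modulus one up to an error of the same order.\<close>

lemma Re_Ln_quotient:
  "\<exists>f. approx 2 f 0 \<and> (\<forall>\<^sub>F m in sequentially. Re (Ln ((1 + G m) / (1 - G m))) = Re (f m))"
proof -
  define y where "y m = \<i> * of_real (C0 / wnum m)" for m
  define r where "r m = G m - y m" for m
  have y: "approx 1 y 0"
    by (rule approx_eqI[OF _ _ approx_cmult[OF inverse_wnum, of "\<i> * C0"]]) (simp_all add: y_def)
  have "approx 1 (\<lambda>m. cwnum m * G m - \<i> * C0) 0"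
    using tanh_of_roots by (simp add: approx_def)
  from approx_0_mult[OF inverse_wnum this] have "approx (1 + 1) r 0"
    by (rule approx_eqI[rotated 2]) (simp_all add: r_def y_def diff_divide_distrib)
  then have r: "approx 2 r 0" by (simp add: numeral_2_eq_2)
  have b: "(\<lambda>m. 1 / (1 + y m)) \<in> O(\<lambda>_. 1)" "(\<lambda>m. 1 / (1 - y m)) \<in> O(\<lambda>_. 1)"
    by (rule approx_imp_bounded[of 1 _ 1], rule approx_eqI[OF refl _ approx_divide[OF approx_const
        approx_add[OF approx_const y]]], simp_all)
      (rule approx_imp_bounded[of 1 _ 1], rule approx_eqI[OF refl _ approx_divide[OF approx_const
          approx_diff[OF approx_const y]]], simp_all)
  \<comment> \<open>Factoring 1 + G = (1 + y) (1 + r / (1 + y)), and 1 - G likewise, isolates (1 +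
    y) / (1 - y), a quotient of complex conjugates and so of modulus one. Only h contributes to the
    real part of the logarithm.\<close>
  define h where "h m = (1 + r m * (1 / (1 + y m))) / (1 - r m * (1 / (1 - y m)))" for m
  have h: "approx 2 h ((1 + 0) / (1 - 0))"
    unfolding h_def
    by (rule approx_divide[OF approx_add[OF approx_const approx_0_bounded[OF r b(1)]]
          approx_diff[OF approx_const approx_0_bounded[OF r b(2)]]]) simp_all
  then have h: "approx 2 h 1" by simp
  have Ln_h: "approx 2 (\<lambda>m. Ln (h m)) 0"
    by (rule approx_eqI[OF refl _ approx_Ln[OF h]]) simp_all
  have "\<forall>\<^sub>F m in sequentially. h m \<noteq> 0" by (rule approx_eventually_neq[OF h]) simp_all
  moreover have "\<forall>\<^sub>F m in sequentially. (1 + G m) / (1 - G m) \<noteq> 0"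
    by (rule approx_eventually_neq[OF quotient]) simp_all
  ultimately have "\<forall>\<^sub>F m in sequentially. Re (Ln ((1 + G m) / (1 - G m))) = Re (Ln (h m))"
  proof eventually_elim
    case (elim m)
    have "Re (1 + y m) = 1" "Re (1 - y m) = 1" by (simp_all add: y_def)
    then have nz: "1 + y m \<noteq> 0" "1 - y m \<noteq> 0"
      by (metis zero_complex.sel(1) zero_neq_one)+
    have "cnj (1 + y m) = 1 - y m" by (simp add: y_def)
    then have norm_eq: "norm (1 + y m) = norm (1 - y m)" by (metis complex_mod_cnj)
    have "(1 + y m) * (1 + r m * (1 / (1 + y m))) = 1 + G m"
      "(1 - y m) * (1 - r m * (1 / (1 - y m))) = 1 - G m"
      using nz by (simp_all add: r_def field_simps)
    then have "(1 + G m) / (1 - G m) = (1 + y m) / (1 - y m) * h m"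
      unfolding h_def by (metis times_divide_times_eq)
    then have "norm ((1 + G m) / (1 - G m)) = norm (h m)"
      using norm_eq nz by (simp add: norm_mult norm_divide)
    then show ?case using elim by simp
  qed
  with Ln_h show ?thesis by blast
qed

end

context plate_wave
begin

lemma slow_eigenvalues:
  "\<exists>l C. C > 0 \<and> (\<forall>\<^sub>F m in sequentially. \<exists>U \<nu>. eigen_family (l m) U \<nu>) \<and>
     filterlim (\<lambda>m. Im (l m)) at_top sequentially \<and>
     (\<forall>\<^sub>F m in sequentially. \<bar>Re (l m)\<bar> * Im (l m) \<le> C)"
proof -
  \<comment> \<open>The expansions require a point of the box for every m, while fixed points are
    available only for large m; for the other m any point of the box serves as a default.\<close>
  have "\<exists>x. x \<in> search_box m \<and> ((\<exists>x\<in>search_box m. eigenvalue_map m x = x \<and> nondegenerate (fst x)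
      (fst (snd x)) (fst (snd (snd x))) (snd (snd (snd x))))
     \<longrightarrow> eigenvalue_map m x = x \<and> nondegenerate (fst x) (fst (snd x)) (fst (snd (snd x))) (snd (snd
         (snd x))))" for m
  proof -
    have "(\<i> * of_real (centre m), 0, 0, 0) \<in> search_box m"
      using root_bound_pos less_imp_le[OF wnum_pos(1)] by (simp add: search_box_def)
    then show ?thesis by blast
  qed
  then obtain x where x: "\<And>m. x m \<in> search_box m"
    and x': "\<And>m. (\<exists>x\<in>search_box m. eigenvalue_map m x = x \<and> nondegenerate (fst x) (fst (snd x))
        (fst (snd (snd x))) (snd (snd (snd x))))
     \<Longrightarrow> eigenvalue_map m (x m) = x m \<and> nondegenerate (fst (x m)) (fst (snd (x m))) (fst (snd (snd
         (x m)))) (snd (snd (snd (x m))))"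
    by metis
  have fixpoint: "\<forall>\<^sub>F m in sequentially. eigenvalue_map m (x m) = x m \<and>
      nondegenerate (fst (x m)) (fst (snd (x m))) (fst (snd (snd (x m)))) (snd (snd (snd (x m))))"
    using eventually_fixpoint by eventually_elim (rule x')
  interpret S: plate_wave_seq a1 a2 b2 g2 d2 t2 k2 "\<lambda>m. fst (x m)" "\<lambda>m. fst (snd (x m))"
    "\<lambda>m. fst (snd (snd (x m)))" "\<lambda>m. snd (snd (snd (x m)))" root_bound
    by (rule plate_wave_seq_search_box[OF x])
  define l where "l m = fst (x m)" for m
  have ev: "\<forall>\<^sub>F m in sequentially. \<exists>U \<nu>. eigen_family (l m) U \<nu>"
    using fixpoint
  proof eventually_elim
    case (elim m)
    obtain l' y1 y2 y3 where "x m = (l', y1, y2, y3)" by (metis prod_cases4)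
    with elim show ?case using eigen_family_fixpoint[of l' y1 y2 y3 m] by (simp add: l_def)
  qed
  have "(\<lambda>m. Im (l m / cwnum m ^ 2)) \<longlonglongrightarrow> root_beta"
    using tendsto_Im[OF approx_tendsto[OF S.lam_W]] by (simp add: l_def)
  moreover have "filterlim (\<lambda>m. (wnum m)\<^sup>2) at_top sequentially"
    using filterlim_wnum by (intro filterlim_pow_at_top) simp_all
  ultimately have "filterlim (\<lambda>m. Im (l m / cwnum m ^ 2) * (wnum m)\<^sup>2) at_top sequentially"
    using parameters_pos by (intro filterlim_tendsto_pos_mult_at_top)
  moreover have "Im (l m / cwnum m ^ 2) * (wnum m)\<^sup>2 = Im (l m)" for m
    by (simp add: Im_divide_of_real flip: of_real_power)
  ultimately have lim: "filterlim (\<lambda>m. Im (l m)) at_top sequentially" by simp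
  obtain f where f: "approx 2 f 0"
    and Re_f: "\<forall>\<^sub>F m in sequentially. Re (Ln ((1 + S.G m) / (1 - S.G m))) = Re (f m)"
    using S.Re_Ln_quotient by blast
  define F where "F m = of_real (wave_speed / (2 * pi)) * f m" for m
  have F: "approx 2 F 0" unfolding F_def using approx_cmult[OF f, of "of_real (wave_speed / (2 *
      pi))"] by simp
  have Re_l: "\<forall>\<^sub>F m in sequentially. Re (l m) = Re (F m)"
    using fixpoint Re_f
  proof eventually_elim
    case (elim m)
    have "l m = fst (eigenvalue_map m (x m))" using elim(1) by (simp add: l_def)
    then have "l m = \<i> * of_real (centre m) + of_real (wave_speed / (2 * pi)) * Ln ((1 + S.G m) /
        (1 - S.G m))"
      by (simp add: eigenvalue_map_def case_prod_unfold)
    moreover have Re_mult: "Re (of_real a * w) = a * Re w" for a w by simp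
    ultimately have "Re (l m) = wave_speed / (2 * pi) * Re (Ln ((1 + S.G m) / (1 - S.G m)))"
      by (simp only: plus_complex.sel Re_i_times Im_complex_of_real Re_mult)
    then show ?case unfolding elim(2) F_def by (simp only: Re_mult)
  qed
  \<comment> \<open>|Re l| is at most |F| = O(M^-2) and Im l at most |l| = O(M^2), so a bound on F l
    bounds their product.\<close>
  have "approx 2 (\<lambda>m. F m * (l m / cwnum m ^ 2)) 0"
    using approx_0_bounded[OF F approx_imp_bounded[OF S.lam_W]] by (simp add: l_def)
  then have "approx (Suc (Suc 0)) (\<lambda>m. F m * (l m / cwnum m ^ 2)) 0" by (simp add: numeral_2_eq_2)
  then have "approx 0 (\<lambda>m. cwnum m * (cwnum m * (F m * (l m / cwnum m ^ 2)))) 0"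
    by (intro approx_wnum_mult)
  then have "approx 0 (\<lambda>m. F m * l m) 0"
    by (rule approx_eqI[rotated 2]) (simp_all add: power2_eq_square)
  then obtain C where C: "C > 0" "\<forall>\<^sub>F m in sequentially. norm (F m * l m - 0) \<le> C * norm (1 /
      cwnum m ^ 0)"
    unfolding approx_def by (elim landau_o.bigE)
  have "\<forall>\<^sub>F m in sequentially. \<bar>Re (l m)\<bar> * Im (l m) \<le> C"
    using C(2) Re_l
  proof eventually_elim
    case (elim m)
    have "\<bar>Re (l m)\<bar> * Im (l m) \<le> \<bar>Re (F m)\<bar> * \<bar>Im (l m)\<bar>"
      unfolding elim(2) by (intro mult_left_mono) auto
    also have "\<dots> \<le> norm (F m) * norm (l m)"
      by (intro mult_mono abs_Re_le_cmod abs_Im_le_cmod) auto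
    also have "\<dots> \<le> C" using elim(1) by (simp add: norm_mult)
    finally show ?case .
  qed
  then show ?thesis using ev lim C(1) by blast
qed

end

theorem theorem4p2:
  fixes a1 a2 b2 g2 d2 t2 k2 :: real
  assumes "a1 > 0" "a2 > 0" "b2 > 0" "g2 > 0" "d2 > 0" "t2 > 0" "k2 > 0"
  shows "\<not> exp_stable a1 a2 b2 g2 d2 t2 k2 \<and>
    (\<forall>\<alpha>::real. \<alpha> < 1 \<longrightarrow>
       Limsup at_infinity (\<lambda>l::real. ereal (\<bar>l\<bar> powr (- \<alpha>)) * res_norm a1 a2 b2 g2 d2 t2 k2 l) = \<infinity>)"
proof -
  interpret plate_wave a1 a2 b2 g2 d2 t2 k2 by unfold_locales (fact assms)+
  obtain l C where "C > 0" "\<forall>\<^sub>F m in sequentially. \<exists>U \<nu>. eigen_family (l m) U \<nu>"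
     "filterlim (\<lambda>m. Im (l m)) at_top sequentially"
     "\<forall>\<^sub>F m in sequentially. \<bar>Re (l m)\<bar> * Im (l m) \<le> C"
    using slow_eigenvalues by blast
  then show ?thesis using slow_eigenvalues_imp by blast
qed

end
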